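(* The Zariski tangent space of $\mathfrak X$ at $\mathcal A$ is the tangent space to the conjugacy orbit $\mathcal O$ of $\mathcal A$: \[ T_{\mathcal A}\mathfrak X=T_{\mathcal A}\mathcal O \] as subspaces of $T_{\mathcal A}\operatorname{Gr}(17,M_6(\mathbb C))$. Consequently, $\dim_{\mathbb C}T_{\mathcal A}\mathfrak X=12$.
   Context: $M_n(\mathbb C)$ is the space of complex $n\times n$ matrices and $[S,T]=ST-TS$. In $2\times2$ blocks, \[ \mathcal A=\left\{\begin{pmatrix}A&B&C\\0&\lambda I_2&D\\0&0&\lambda I_2\end{pmatrix}: A,B,C,D\in M_2(\mathbb C),\ \lambda\in\mathbb C\right\}\subseteq M_6(\mathbb C), \] which has dimension $17$. $\operatorname{Gr}(17,M_6(\mathbb C))$ is the Grassmannian of $17$-dimensional linear subspaces of $M_6(\mathbb C)$, and \[ \mathfrak X=\{\mathcal V\in\operatorname{Gr}(17,M_6(\mathbb C)):\operatorname{rank}[S,T]\le 2\text{ for all }S,T\in\mathcal V\}, \] which is a closed algebraic subset of the Grassmannian. $\operatorname{GL}_6(\mathbb C)$ acts on the Grassmannian by conjugation, $g\cdot\mathcal V=g\mathcal Vg^{-1}$, and $\mathcal O=\operatorname{GL}_6(\mathbb C)\cdot\mathcal A$, which is a closed nonsingular subvariety of the Grassmannian contained in $\mathfrak X$. Algebraic sets and Zariski tangent spaces are understood in the classical sense over $\mathbb C$: in an affine chart of the Grassmannian, the Zariski tangent space of a closed algebraic set at a point is the common kernel of the differentials at that point of all polynomials in the vanishing ideal of the set.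 *)

theory Defs
  imports "HOL-Analysis.Analysis"
begin

text \<open>The library has no scalar multiplication of matrices by complex numbers: on
  \<open>complex^'n^'m\<close> the operator \<open>*s\<close> takes scalars in \<open>complex^'n\<close>, and \<open>*\<^sub>R\<close> is real.\<close>

definition cscale :: "complex \<Rightarrow> complex^'n^'m \<Rightarrow> complex^'n^'m" where
  "cscale c M = (\<chi> i j. c * M $ i $ j)"

interpretation cmat: vector_space cscale
  by unfold_locales (simp_all add: cscale_def vec_eq_iff algebra_simps)

definition commutator :: "complex^'n^'n \<Rightarrow> complex^'n^'n \<Rightarrow> complex^'n^'n" where
  "commutator S T = S ** T - T ** S"

definition grassmannian :: "nat \<Rightarrow> (complex^'n^'n) set set" where
  "grassmannian k = {V. cmat.subspace V \<and> cmat.dim V = k}"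

definition conj_act :: "complex^'n^'n \<Rightarrow> (complex^'n^'n) set \<Rightarrow> (complex^'n^'n) set" where
  "conj_act g V = (\<lambda>M. g ** M ** matrix_inv g) ` V"


subsection \<open>Affine charts of the Grassmannian\<close>

definition is_basis :: "('i \<Rightarrow> complex^'n^'n) \<Rightarrow> bool" where
  "is_basis e \<longleftrightarrow> inj e \<and> cmat.independent (range e) \<and> cmat.span (range e) = UNIV"

text \<open>A basis indexed by \<open>'k + 'l\<close> gives a standard affine chart of the Grassmannian of
  \<open>CARD('k)\<close>-dimensional subspaces. Its domain consists of the subspaces complementary to the
  span of the vectors \<open>e (Inr j)\<close>; the matrix \<open>X\<close> of coordinates corresponds to the graph of the
  linear map with matrix \<open>X\<close> from the span of the \<open>e (Inl i)\<close> to the span of the \<open>e (Inr j)\<close>.\<close>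

definition gr_chart ::
    "('k::finite + 'l::finite \<Rightarrow> complex^'n^'n) \<Rightarrow> complex^'l^'k \<Rightarrow> (complex^'n^'n) set" where
  "gr_chart e X =
     cmat.span (range (\<lambda>i. e (Inl i) + (\<Sum>j\<in>UNIV. cscale (X $ i $ j) (e (Inr j)))))"


subsection \<open>Zariski tangent spaces in affine space\<close>

text \<open>Polynomials in the coordinates of \<open>complex^'l^'k\<close>; as the field is infinite they may be
  identified with the functions they define.\<close>

inductive cpolynomial :: "(complex^'l^'k \<Rightarrow> complex) \<Rightarrow> bool" where
  const: "cpolynomial (\<lambda>X. c)"
| coord: "cpolynomial (\<lambda>X. X $ i $ j)"
| add: "cpolynomial p \<Longrightarrow> cpolynomial q \<Longrightarrow> cpolynomial (\<lambda>X. p X + q X)"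
| mult: "cpolynomial p \<Longrightarrow> cpolynomial q \<Longrightarrow> cpolynomial (\<lambda>X. p X * q X)"

definition vanishing_ideal :: "(complex^'l^'k) set \<Rightarrow> (complex^'l^'k \<Rightarrow> complex) set" where
  "vanishing_ideal Z = {p. cpolynomial p \<and> (\<forall>X\<in>Z. p X = 0)}"

text \<open>The real Frechet derivative of a polynomial is complex-linear, and coincides with its
  algebraic differential.\<close>

definition zariski_tangent :: "(complex^'l^'k) set \<Rightarrow> complex^'l^'k \<Rightarrow> (complex^'l^'k) set" where
  "zariski_tangent Z X0 = {Y. \<forall>p\<in>vanishing_ideal Z. frechet_derivative p (at X0) Y = 0}"

text \<open>The tangent space at the point \<open>gr_chart e X0\<close> of a closed subset \<open>S\<close> of the Grassmannian,
  in the coordinates of the chart given by \<open>e\<close>, in which the tangent space of the Grassmannian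
  itself is all of \<open>complex^'l^'k\<close>.\<close>

definition gr_tangent ::
    "('k::finite + 'l::finite \<Rightarrow> complex^'n^'n) \<Rightarrow> (complex^'n^'n) set set \<Rightarrow> complex^'l^'k
      \<Rightarrow> (complex^'l^'k) set" where
  "gr_tangent e S X0 = zariski_tangent (gr_chart e -` S) X0"


subsection \<open>The spaces of \<open>6 \<times> 6\<close> matrices\<close>

text \<open>The elements of the index type \<open>6\<close> are taken in the order \<open>1, 2, 3, 4, 5, 6\<close>, where
  \<open>6 = 0\<close>; similarly \<open>3 = 0\<close> in the type \<open>3\<close> and \<open>2 = 0\<close> in the type \<open>2\<close>.\<close>

definition block_of :: "6 \<Rightarrow> 3" where
  "block_of i = (if i \<in> {1, 2} then 1 else if i \<in> {3, 4} then 2 else 3)"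

definition pos_in_block :: "6 \<Rightarrow> 2" where
  "pos_in_block i = (if i \<in> {1, 3, 5} then 1 else 2)"

definition block_matrix :: "complex^2^2^3^3 \<Rightarrow> complex^6^6" where
  "block_matrix M =
     (\<chi> i j. M $ block_of i $ block_of j $ pos_in_block i $ pos_in_block j)"

definition \<A> :: "(complex^6^6) set" where
  "\<A> = {block_matrix
          (vector [vector [A, B,          C],
                   vector [0, mat lambda, D],
                   vector [0, 0, mat lambda]]) | A B C D lambda. True}"

definition \<XX> :: "(complex^6^6) set set" where
  "\<XX> = {V \<in> grassmannian 17. \<forall>S\<in>V. \<forall>T\<in>V. rank (commutator S T) \<le> 2}"

definition \<O> :: "(complex^6^6) set set" where
  "\<O> = {conj_act g \<A> | g. invertible g}"

end

theory Submission
  imports Defs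
begin

text \<open>
  Write \<open>E\<^sub>1\<close> for the span of the first two basis vectors of \<open>\<complex>\<^sup>6\<close>. A commutator of two elements of
  \<open>\<A>\<close> has nonzero blocks only in its first block row, because modulo \<open>E\<^sub>1\<close> the elements of \<open>\<A>\<close>
  act by commuting matrices. So all these commutators have image in \<open>E\<^sub>1\<close> and rank at most \<open>2\<close>, the
  orbit \<open>\<O>\<close> lies in \<open>\<XX>\<close>, and the tangent space of \<open>\<O>\<close> is contained in that of \<open>\<XX>\<close>. The theorem
  says that the linearized equations of \<open>\<XX>\<close> at \<open>\<A>\<close> have no other solutions.

  A chart at \<open>\<A>\<close> amounts to a basis \<open>a\<close> of \<open>\<A>\<close> and a complement of \<open>\<A>\<close>, and a tangent vector \<open>Y\<close>
  to a linear map \<open>\<phi>\<close> from \<open>\<A>\<close> to the complement. If \<open>Y\<close> is tangent to \<open>\<XX>\<close>, then the derivatives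
  at \<open>\<A>\<close> of the \<open>3 \<times> 3\<close> minors of all commutators vanish along \<open>Y\<close>. When \<open>[S, T]\<close> maps onto
  \<open>E\<^sub>1\<close>, this says that \<open>[\<phi> S, T] + [S, \<phi> T]\<close> maps the kernel of \<open>[S, T]\<close> into \<open>E\<^sub>1\<close>: for a
  matrix of rank exactly \<open>2\<close> the tangent space of the rank locus consists of the matrices that map
  its kernel into its image (\<open>tangent_first_order_solution\<close>).

  The algebraic core (\<open>\<phi>_is_inner\<close>) is that every such \<open>\<phi>\<close> equals \<open>S \<mapsto> [x, S]\<close> modulo \<open>\<A>\<close> for a
  strictly lower block triangular \<open>x\<close>. It suffices to use pairs in which the upper left blocks of
  \<open>S\<close> and \<open>T\<close> have invertible commutator; then \<open>[S, T]\<close> maps onto \<open>E\<^sub>1\<close> and its kernel is the graph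
  of an explicit map. Almost always these upper left blocks are two anticommuting Pauli matrices,
  and the other blocks of \<open>S\<close> and \<open>T\<close> are free parameters.

  Conversely \<open>S \<mapsto> [x, S]\<close> is tangent to \<open>\<O>\<close>. By additivity it is enough to take for \<open>x\<close> a multiple
  of a matrix unit off the diagonal. Then \<open>x\<close> has square zero, \<open>1 + t x\<close> has inverse \<open>1 - t x\<close>, and
  Cramer's rule shows that the coordinates of \<open>(1 + t x) \<A> (1 - t x)\<close> are holomorphic functions of
  \<open>t\<close> near \<open>0\<close>; their derivative at \<open>0\<close> is the given vector
  (\<open>inner_tangent_in_tangent_\<O>\<close>). Hence both tangent spaces equal the space of all
  \<open>S \<mapsto> [x, S]\<close> with \<open>x\<close> strictly lower block triangular. As \<open>x\<close> can be recovered from this map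
  (\<open>inner_tangent_eq_0\<close>), the dimension is the number of positions below the diagonal blocks,
  which is \<open>3 * 4 = 12\<close>.
\<close>

section \<open>Matrix algebra\<close>

lemma cscale_component [simp]: "cscale c M $ i $ j = c * M $ i $ j"
  by (simp add: cscale_def)

lemma matrix_diff_ldistrib: "A ** (B - C) = A ** B - A ** (C :: 'a::ring_1^'p^'n)"
  and matrix_diff_rdistrib: "(B' - C') ** A' = B' ** A' - C' ** (A' :: 'a::ring_1^'p^'n)"
  and matrix_add_rdistrib: "(B' + C') ** A' = B' ** A' + C' ** A'"
  and matrix_minus_right: "A ** (- B) = - (A ** B)"
  and matrix_minus_left: "(- A) ** B = - (A ** B)"
  by (simp_all add: vec_eq_iff matrix_matrix_mult_def algebra_simps sum_subtractf sum.distrib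
      sum_negf)

text \<open>The type of matrices carries the entrywise ring structure, in which \<open>2 * A\<close> is \<open>A + A\<close>; the
  simplifier introduces such multiples.\<close>

lemma matrix_mult_numeral:
  "A ** (numeral n * B) = numeral n * (A ** (B :: complex^'p^'n))"
  "(numeral n * A') ** B = numeral n * (A' ** B)"
  by (simp_all add: vec_eq_iff matrix_matrix_mult_def sum_distrib_left ac_simps)

lemmas matrix_distribs = matrix_mult_numeral matrix_add_ldistrib matrix_add_rdistrib
    matrix_diff_ldistrib
  matrix_diff_rdistrib matrix_minus_left matrix_minus_right

lemma cscale_mult_left: "cscale c A ** B = cscale c (A ** B)"
  and cscale_mult_right: "A ** cscale c B = cscale c (A ** B)"
  by (simp_all add: vec_eq_iff matrix_matrix_mult_def sum_distrib_left ac_simps)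

abbreviation clinear :: "(complex^'n^'m \<Rightarrow> complex^'q^'p) \<Rightarrow> bool" where
  "clinear f \<equiv> Vector_Spaces.linear cscale cscale f"

lemma clinearI:
  assumes "\<And>X Y. f (X + Y) = f X + f Y" "\<And>c X. f (cscale c X) = cscale c (f X)"
  shows "clinear f"
  using assms unfolding Vector_Spaces.linear_iff by (simp add: cmat.vector_space_axioms)

lemma clinearD:
  assumes "clinear f"
  shows clinear_add: "f (X + Y) = f X + f Y" and clinear_cscale: "f (cscale c X) = cscale c (f X)"
    and clinear_zero: "f 0 = 0" and clinear_minus: "f (- X) = - f X"
proof -
  interpret Vector_Spaces.linear cscale cscale f by fact
  show "f (X + Y) = f X + f Y" "f (cscale c X) = cscale c (f X)" "f 0 = 0" "f (- X) = - f X"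
    by (simp_all add: add scale zero neg)
qed

definition mat_unit :: "'m \<Rightarrow> 'n \<Rightarrow> complex^'n^'m" where
  "mat_unit k l = (\<chi> i j. if i = k \<and> j = l then 1 else 0)"

lemma mat_unit_component [simp]: "mat_unit k l $ i $ j = (if i = k \<and> j = l then 1 else 0)"
  by (simp add: mat_unit_def)

lemma double_cancel: "A + A = B + B \<Longrightarrow> A = (B :: complex^'n^'m)"
  by (simp add: vec_eq_iff flip: mult_2)

lemma two_cancel: "2 * A = 2 * B \<longleftrightarrow> A = B" and two_eq_0: "2 * A = 0 \<longleftrightarrow> A = 0"
  for A B :: "complex^'n^'m"
  by (simp_all add: vec_eq_iff)

text \<open>Stated for families, so that injectivity need not be known beforehand: a repeated vector
  would already give a nontrivial relation.\<close>

lemma independent_familyI: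
  assumes fin: "finite I"
    and *: "\<And>c. (\<Sum>i\<in>I. cscale (c i) (w i)) = 0 \<Longrightarrow> \<forall>i\<in>I. c i = 0"
  shows "inj_on w I" and "cmat.independent (w ` I)"
proof -
  show inj: "inj_on w I"
  proof (rule inj_onI, rule ccontr)
    fix i j assume ij: "i \<in> I" "j \<in> I" "w i = w j" "i \<noteq> j"
    let ?c = "\<lambda>k. (if k = i then 1 else 0) - (if k = j then 1 else 0) :: complex"
    have "(\<Sum>k\<in>I. cscale (?c k) (w k)) = (\<Sum>k\<in>I. (if k = i then w k else 0) - (if k
        = j then w k else 0))"
      by (intro sum.cong refl) (auto simp: vec_eq_iff)
    also have "\<dots> = 0" using ij fin by (simp add: sum_subtractf)
    finally have "\<forall>k\<in>I. ?c k = 0" by (rule *)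
    then show False using ij by (metis diff_zero one_neq_zero)
  qed
  show "cmat.independent (w ` I)"
  proof (rule cmat.independent_if_scalars_zero)
    fix f x assume f: "(\<Sum>x\<in>w ` I. cscale (f x) x) = 0" and x: "x \<in> w ` I"
    then have "(\<Sum>i\<in>I. cscale (f (w i)) (w i)) = 0" by (simp add: sum.reindex[OF inj])
    then show "f x = 0" using *[of "\<lambda>i. f (w i)"] x by blast
  qed (use fin in simp)
qed

lemma clinear_sum:
  assumes f: "clinear f" shows "f (\<Sum>i\<in>I. w i) = (\<Sum>i\<in>I. f (w i))"
  by (induction I rule: infinite_finite_induct) (simp_all add: clinear_zero[OF f] clinear_add[OF f])

lemma clinear_span_image:
  assumes "clinear f" shows "f ` cmat.span S = cmat.span (f ` S)"
proof -
  interpret Vector_Spaces.linear cscale cscale f by fact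
  show ?thesis by (rule span_image[symmetric])
qed

lemma clinear_conj: "clinear (\<lambda>M. g ** M ** h)"
  by (rule clinearI) (simp_all add: matrix_distribs cscale_mult_left cscale_mult_right)

lemma conj_commutator:
  fixes g h :: "complex^'n^'n"
  assumes "h ** g = mat 1"
  shows "commutator (g ** S ** h) (g ** T ** h) = g ** commutator S T ** h"
proof -
  have *: "h ** (g ** M) = M" for M by (simp add: matrix_mul_assoc assms)
  show ?thesis unfolding commutator_def
    by (simp add: matrix_diff_ldistrib matrix_diff_rdistrib * flip: matrix_mul_assoc)
qed

lemma conj_inverse:
  fixes g h :: "complex^'n^'n"
  assumes "g ** h = mat 1" "h ** g = mat 1"
  shows "invertible g" and "matrix_inv g = h"
proof -
  show "invertible g" using assms by (auto simp: invertible_def)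
  have "g ** matrix_inv g = mat 1"
    unfolding matrix_inv_def using assms by (metis (mono_tags, lifting) someI_ex)
  then have "h ** (g ** matrix_inv g) = h" by simp
  then show "matrix_inv g = h" by (simp add: matrix_mul_assoc assms)
qed

section \<open>Rank and determinant\<close>

lemma row_matrix_mult: "row i (A ** B) = row i A v* (B :: 'a::comm_semiring_1^'p^'n)"
  by (simp add: row_def matrix_matrix_mult_def vector_matrix_mult_def vec_eq_iff mult.commute)

lemma rank_mult_le_right:
  fixes A :: "'a::field^'n^'m" and B :: "'a^'p^'n"
  shows "rank (A ** B) \<le> rank B"
proof -
  have "row i A v* B \<in> vec.span (rows B)" for i
  proof -
    have "row i A v* B = (\<Sum>j\<in>UNIV. (row i A $ j) *s row j B)"
      by (simp add: vector_matrix_mult_def vec_eq_iff row_def mult.commute)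
    also have "\<dots> \<in> vec.span (rows B)"
      by (intro vec.span_sum vec.span_scale vec.span_base) (auto simp: rows_def)
    finally show ?thesis .
  qed
  then have "rows (A ** B) \<subseteq> vec.span (rows B)"
    by (auto simp: rows_def row_matrix_mult)
  then show ?thesis
    unfolding row_rank_def_gen by (metis vec.dim_span vec.dim_subset)
qed

lemma rank_mult_le_left:
  fixes A :: "'a::field^'n^'m" and B :: "'a^'p^'n"
  shows "rank (A ** B) \<le> rank A"
proof -
  have "rows (A ** B) = (\<lambda>r. r v* B) ` rows A"
    by (auto simp: rows_def row_matrix_mult)
  moreover have "Vector_Spaces.linear (*s) (*s) (\<lambda>r. r v* B)"
    by unfold_locales (simp_all add: vector_matrix_mult_def vec_eq_iff sum.distrib sum_distrib_left
        algebra_simps)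
  ultimately show ?thesis
    unfolding row_rank_def_gen by (metis vec.dim_image_le)
qed

lemma det_eq_0_if_rank_less:
  fixes A :: "'a::field^'n^'n"
  assumes "rank A < CARD('n)"
  shows "det A = 0"
proof (rule ccontr)
  assume "det A \<noteq> 0"
  then have "\<exists>B. B ** A = mat 1" by (meson invertible_det_nz invertible_left_inverse)
  then have "vec.span (rows A) = UNIV" by (simp add: matrix_left_invertible_span_rows_gen)
  then have "vec.dim (rows A) = CARD('n)"
    by (metis vec.dim_span vec.dim_UNIV vec_dim_card)
  then show False using assms by (simp add: row_rank_def_gen)
qed

text \<open>Minors with respect to arbitrary rows and columns. Unlike plain submatrices they can be
  adapted to a given matrix of rank two, so that its compression becomes the diagonal matrix with
  entries \<open>1, 1, 0\<close>.\<close>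

lemma minor_eq_0_if_rank_le_2:
  fixes M :: "complex^6^6" and U :: "complex^6^3" and W :: "complex^3^6"
  assumes "rank M \<le> 2"
  shows "det (U ** M ** W) = 0"
proof (rule det_eq_0_if_rank_less)
  show "rank (U ** M ** W) < CARD(3)"
    using assms rank_mult_le_left[of "U ** M" W] rank_mult_le_right[of U M] by simp
qed

lemma det_field_differentiable:
  fixes F :: "complex \<Rightarrow> complex^'n^'n"
  assumes "\<And>i j. (\<lambda>t. F t $ i $ j) field_differentiable (at z)"
  shows "(\<lambda>t. det (F t)) field_differentiable (at z)"
proof -
  have prod: "(\<lambda>t. \<Prod>i\<in>I. F t $ i $ \<pi> i) field_differentiable (at z)" for I \<pi>
    by (induction I rule: infinite_finite_induct)
      (simp_all add: field_differentiable_mult assms)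
  show ?thesis
    unfolding det_def by (intro field_differentiable_sum field_differentiable_mult
        field_differentiable_const prod)
qed

text \<open>At the diagonal matrix with entries \<open>1, 1, 0\<close> the differential of the determinant is the
  lower right entry: every other product in the Leibniz formula contains two factors that vanish
  there.\<close>

lemma det_expansion_first_order:
  fixes G H K :: "complex^3^3"
  assumes G: "G $ 1 $ 1 = 1" "G $ 1 $ 2 = 0" "G $ 2 $ 1 = 0" "G $ 2 $ 2 = 1"
    "G $ 1 $ 3 = 0" "G $ 2 $ 3 = 0" "G $ 3 $ 3 = 0" "G $ 3 $ 1 = 0" "G $ 3 $ 2 = 0"
    and zero: "((\<lambda>t. det (G + cscale t H + cscale (t * t) K)) has_field_derivative 0) (at 0)"
  shows "H $ 3 $ 3 = 0"
proof -
  have "((\<lambda>t. det (G + cscale t H + cscale (t * t) K)) has_field_derivative H $ 3 $ 3) (at 0)"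
    unfolding det_3 by (auto simp: G intro!: derivative_eq_intros)
  then show ?thesis using zero DERIV_unique by blast
qed

section \<open>Polynomials and Zariski tangent spaces\<close>

lemma cpolynomial_sum:
  assumes "\<And>i. i \<in> I \<Longrightarrow> cpolynomial (p i)"
  shows "cpolynomial (\<lambda>X. \<Sum>i\<in>I. p i X)"
  using assms by (induction I rule: infinite_finite_induct) (simp_all add: cpolynomial.intros)

lemma cpolynomial_diff:
  assumes "cpolynomial p" "cpolynomial q"
  shows "cpolynomial (\<lambda>X. p X - q X)"
proof -
  have "cpolynomial (\<lambda>X. p X + (-1) * q X)" by (intro cpolynomial.intros assms)
  then show ?thesis by simp
qed

lemma cpolynomial_differentiable: "cpolynomial p \<Longrightarrow> p differentiable (at X)"
  by (induction rule: cpolynomial.induct)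
    (auto intro!: differentiable_add differentiable_mult bounded_linear_imp_differentiable
       bounded_linear_compose[OF bounded_linear_vec_nth bounded_linear_vec_nth])

text \<open>The curve has a complex parameter although the derivative of \<open>p\<close> is the real one: the latter
  is complex linear for polynomials. It is enough that the entries of the curve be complex
  differentiable, which spares a discussion of derivatives of matrix-valued functions.\<close>

lemma cpolynomial_chain:
  fixes Z :: "complex \<Rightarrow> complex^'l^'k"
  assumes "cpolynomial p"
    and Z: "\<And>i j. ((\<lambda>t. Z t $ i $ j) has_field_derivative Y $ i $ j) (at 0)"
  shows "((\<lambda>t. p (Z t)) has_field_derivative frechet_derivative p (at (Z 0)) Y) (at 0)"
  using assms(1)
proof (induction rule: cpolynomial.induct)
  case (const c)
  then show ?case by (simp add: frechet_derivative_const)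
next
  case (coord i j)
  have "bounded_linear (\<lambda>X :: complex^'l^'k. X $ i $ j)"
    by (rule bounded_linear_compose[OF bounded_linear_vec_nth bounded_linear_vec_nth])
  then have "((\<lambda>X :: complex^'l^'k. X $ i $ j) has_derivative (\<lambda>X. X $ i $ j)) (at (Z 0))"
    by (rule bounded_linear_imp_has_derivative)
  then have "frechet_derivative (\<lambda>X :: complex^'l^'k. X $ i $ j) (at (Z 0)) = (\<lambda>X. X $ i $ j)"
    by (rule frechet_derivative_at[symmetric])
  then show ?case using Z[of i j] by simp
next
  case (add p q)
  have "((\<lambda>X. p X + q X) has_derivative
      (\<lambda>Y. frechet_derivative p (at (Z 0)) Y + frechet_derivative q (at (Z 0)) Y)) (at (Z 0))"
    using add.hyps[THEN cpolynomial_differentiable] by (intro has_derivative_add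
        frechet_derivative_works[THEN iffD1])
  from frechet_derivative_at[OF this, symmetric] show ?case
    using DERIV_add[OF add.IH] by simp
next
  case (mult p q)
  have "((\<lambda>X. p X * q X) has_derivative
      (\<lambda>Y. p (Z 0) * frechet_derivative q (at (Z 0)) Y + frechet_derivative p (at (Z 0)) Y * q (Z
          0))) (at (Z 0))"
    using mult.hyps[THEN cpolynomial_differentiable] by (intro has_derivative_mult
        frechet_derivative_works[THEN iffD1])
  from frechet_derivative_at[OF this, symmetric] show ?case
    using DERIV_mult[OF mult.IH] by (simp add: ac_simps)
qed

lemma zariski_tangent_add:
  assumes "Y \<in> zariski_tangent Z X" "Y' \<in> zariski_tangent Z X"
  shows "Y + Y' \<in> zariski_tangent Z X"
proof -
  have "frechet_derivative p (at X) (Y + Y') = frechet_derivative p (at X) Y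
      + frechet_derivative p (at X) Y'"
    if "p \<in> vanishing_ideal Z" for p
    using that by (intro linear_add linear_frechet_derivative) (simp add: vanishing_ideal_def
        cpolynomial_differentiable)
  then show ?thesis using assms by (simp add: zariski_tangent_def)
qed

lemma zariski_tangent_zero: "0 \<in> zariski_tangent Z X"
proof -
  have "frechet_derivative p (at X) 0 = 0" if "p \<in> vanishing_ideal Z" for p
    using that by (intro linear_0 linear_frechet_derivative) (simp add: vanishing_ideal_def
        cpolynomial_differentiable)
  then show ?thesis by (simp add: zariski_tangent_def)
qed

lemma zariski_tangent_mono: "Z \<subseteq> Z' \<Longrightarrow> zariski_tangent Z X \<subseteq> zariski_tangent Z' X"
  by (auto simp: zariski_tangent_def vanishing_ideal_def)

lemma zariski_tangent_sum:
  "(\<And>i. i \<in> I \<Longrightarrow> Y i \<in> zariski_tangent Z X) \<Longrightarrow> (\<Sum>i\<in>I. Y i) \<in> zariski_tangent Z X"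
  by (induction I rule: infinite_finite_induct) (simp_all add: zariski_tangent_zero
      zariski_tangent_add)

text \<open>Matrices of polynomials are closed under products, so that minors of commutators are visibly
  polynomials.\<close>

definition mat_polynomial :: "(complex^'l^'k \<Rightarrow> complex^'n^'m) \<Rightarrow> bool" where
  "mat_polynomial F \<longleftrightarrow> (\<forall>i j. cpolynomial (\<lambda>X. F X $ i $ j))"

lemma mat_polynomial_const: "mat_polynomial (\<lambda>X. M)"
  by (simp add: mat_polynomial_def cpolynomial.const)

lemma mat_polynomial_mult:
  "mat_polynomial F \<Longrightarrow> mat_polynomial G \<Longrightarrow> mat_polynomial (\<lambda>X. F X ** G X)"
  by (simp add: mat_polynomial_def matrix_matrix_mult_def cpolynomial_sum cpolynomial.mult)

lemma mat_polynomial_commutator: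
  "mat_polynomial F \<Longrightarrow> mat_polynomial G \<Longrightarrow> mat_polynomial (\<lambda>X. commutator (F X) (G X))"
  using mat_polynomial_mult[of F G] mat_polynomial_mult[of G F]
  by (simp add: mat_polynomial_def commutator_def cpolynomial_diff)

lemma cpolynomial_det_3: "mat_polynomial F \<Longrightarrow> cpolynomial (\<lambda>X. det (F X :: complex^3^3))"
  unfolding det_3 mat_polynomial_def
  by (intro cpolynomial_diff cpolynomial.add cpolynomial.mult) blast+

section \<open>Block decomposition of matrices of order six\<close>

lemma UNIV_6: "(UNIV::6 set) = {1,2,3,4,5,6}"
proof -
  have "card {1,2,3,4,5,6::6} = 6" by (simp)
  then show ?thesis by (intro card_subset_eq[symmetric]) auto
qed

lemma forall_6: "(\<forall>i::6. P i) \<longleftrightarrow> P 1 \<and> P 2 \<and> P 3 \<and> P 4 \<and> P 5 \<and> P 6"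
proof -
  have "(\<forall>i::6. P i) \<longleftrightarrow> (\<forall>i\<in>{1,2,3,4,5,6}. P i)"
    unfolding UNIV_6[symmetric] by simp
  then show ?thesis by simp
qed

lemma sum_6: "sum f (UNIV::6 set) = f 1 + f 2 + f 3 + f 4 + f 5 + f 6"
  unfolding UNIV_6 by (simp add: add.assoc)

text \<open>The inverse of \<open>i \<mapsto> (block_of i, pos_in_block i)\<close>.\<close>

definition block_index :: "3 \<Rightarrow> 2 \<Rightarrow> 6" where
  "block_index k p =
     (if k = 1 then if p = 1 then 1 else 2
      else if k = 2 then if p = 1 then 3 else 4
      else if p = 1 then 5 else 6)"

definition block :: "3 \<Rightarrow> 3 \<Rightarrow> complex^6^6 \<Rightarrow> complex^2^2" where
  "block k l M = (\<chi> p q. M $ block_index k p $ block_index l q)"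

text \<open>Kernel vectors are handled two at a time, as the columns of a \<open>6 \<times> 2\<close> matrix: its row blocks
  are then square like all other blocks, and the kernel condition becomes an identity between \<open>2 \<times>
  2\<close> matrices.\<close>

definition row_block :: "3 \<Rightarrow> complex^2^6 \<Rightarrow> complex^2^2" where
  "row_block k V = (\<chi> p q. V $ block_index k p $ q)"

definition stack :: "complex^2^2 \<Rightarrow> complex^2^2 \<Rightarrow> complex^2^2 \<Rightarrow> complex^2^6" where
  "stack V1 V2 V3 = (\<chi> i q. (vector [V1, V2, V3] :: complex^2^2^3) $ block_of i $ pos_in_block i $ q)"

lemma block_of_block_index [simp]: "block_of (block_index k p) = k"
  using exhaust_3[of k] exhaust_2[of p] by (auto simp: block_of_def block_index_def)

lemma pos_in_block_block_index [simp]: "pos_in_block (block_index k p) = p"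
  using exhaust_3[of k] exhaust_2[of p] by (auto simp: pos_in_block_def block_index_def)

lemma block_index_block_of [simp]: "block_index (block_of i) (pos_in_block i) = i"
proof -
  have "\<forall>i. block_index (block_of i) (pos_in_block i) = i"
    unfolding forall_6 by (simp add: block_index_def block_of_def pos_in_block_def)
  then show ?thesis by blast
qed

lemma sum_block_index:
  "sum f (UNIV::6 set) = (\<Sum>p\<in>UNIV. f (block_index 1 p)) + (\<Sum>p\<in>UNIV. f (block_index 2 p))
     + (\<Sum>p\<in>UNIV. f (block_index 3 p))"
  by (simp add: sum_6 sum_2 block_index_def add.assoc)

lemma block_mult:
  "block k l (M ** N) =
     block k 1 M ** block 1 l N + block k 2 M ** block 2 l N + block k 3 M ** block 3 l N"
  by (simp add: vec_eq_iff block_def matrix_matrix_mult_def sum_block_index)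

lemma row_block_mult:
  "row_block k (M ** V) =
     block k 1 M ** row_block 1 V + block k 2 M ** row_block 2 V + block k 3 M ** row_block 3 V"
  by (simp add: vec_eq_iff block_def row_block_def matrix_matrix_mult_def sum_block_index)

lemma block_add: "block k l (M + N) = block k l M + block k l N"
  and block_diff: "block k l (M - N) = block k l M - block k l N"
  and block_cscale: "block k l (cscale c M) = cscale c (block k l M)"
  and block_zero: "block k l 0 = 0"
  by (simp_all add: block_def cscale_def vec_eq_iff)

lemma row_block_add: "row_block k (V + W) = row_block k V + row_block k W"
  and row_block_diff: "row_block k (V - W) = row_block k V - row_block k W"
  and row_block_zero: "row_block k 0 = 0"
  by (simp_all add: row_block_def vec_eq_iff)

lemma block_block_matrix [simp]: "block k l (block_matrix M) = M $ k $ l"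
  by (simp add: block_def block_matrix_def vec_eq_iff)

lemma row_block_stack [simp]:
  "row_block 1 (stack V1 V2 V3) = V1" "row_block 2 (stack V1 V2 V3) = V2"
  "row_block 3 (stack V1 V2 V3) = V3"
  by (simp_all add: row_block_def stack_def vec_eq_iff)

lemma block_eqI: "(\<And>k l. block k l M = block k l N) \<Longrightarrow> M = N"
  unfolding block_def vec_eq_iff by simp (metis block_index_block_of)

lemma row_block_eqI:
  assumes "\<And>k. row_block k V = row_block k W" shows "V = W"
  using assms unfolding row_block_def vec_eq_iff by simp (metis block_index_block_of)

lemma block_index_eq_iff: "block_index k p = block_index l q \<longleftrightarrow> k = l \<and> p = q"
  by (metis block_of_block_index pos_in_block_block_index)

lemma block_mat: "block k l (mat c) = (if k = l then mat c else 0)"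
  by (simp add: block_def mat_def vec_eq_iff block_index_eq_iff)

lemma entry_block: "M $ i $ j = block (block_of i) (block_of j) M $ pos_in_block i $ pos_in_block j"
  by (simp add: block_def)

section \<open>Two by two matrices\<close>

lemmas mat2_eq = vec_eq_iff forall_2

lemma mat2_mult: "(A ** B) $ i $ j = A $ i $ 1 * B $ 1 $ j + A $ i $ 2 * B $ 2 $ j"
  for A :: "complex^2^'m" by (simp add: matrix_matrix_mult_def sum_2)

text \<open>The identity, two anticommuting involutions and their product form a basis of the \<open>2 \<times> 2\<close>
  matrices. The product of the two involutions is invertible and equal to half their commutator,
  so kernels of the commutators below have closed expressions without inverses.\<close>

definition pauli_x :: "complex^2^2" where "pauli_x = vector [vector [0, 1], vector [1, 0]]"
definition pauli_z :: "complex^2^2" where "pauli_z = vector [vector [1, 0], vector [0, -1]]"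

lemma pauli_components [simp]:
  "pauli_x $ 1 $ 1 = 0" "pauli_x $ 1 $ 2 = 1" "pauli_x $ 2 $ 1 = 1" "pauli_x $ 2 $ 2 = 0"
  "pauli_z $ 1 $ 1 = 1" "pauli_z $ 1 $ 2 = 0" "pauli_z $ 2 $ 1 = 0" "pauli_z $ 2 $ 2 = -1"
  by (simp_all add: pauli_x_def pauli_z_def)

lemma mat_components [simp]: "(mat c :: complex^2^2) $ 1 $ 1 = c" "(mat c :: complex^2^2) $ 1 $ 2 = 0"
  "(mat c :: complex^2^2) $ 2 $ 1 = 0" "(mat c :: complex^2^2) $ 2 $ 2 = c"
  by (simp_all add: mat_def)

lemma scalar_mat_commute: "X ** mat s = mat s ** (X :: complex^2^2)"
  by (simp add: mat2_eq mat2_mult)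

text \<open>Oriented so that products are rewritten to a normal form with \<open>pauli_z\<close> on the left.\<close>

lemma pauli_mult [simp]:
  "pauli_x ** pauli_x = mat 1" "pauli_z ** pauli_z = mat 1"
  "pauli_x ** pauli_z = - (pauli_z ** pauli_x)"
  by (simp_all add: mat2_eq mat2_mult)

lemma pauli_mult_assoc [simp]:
  "pauli_x ** (pauli_x ** M) = M" "pauli_z ** (pauli_z ** M) = M"
  "pauli_x ** (pauli_z ** M) = - (pauli_z ** (pauli_x ** M))"
  by (simp_all add: matrix_mul_assoc) (simp add: matrix_minus_left)

lemma pauli_linear_eq_0:
  fixes f :: "complex^2^2 \<Rightarrow> complex^'n^'m"
  assumes f: "clinear f" and 0: "f (mat 1) = 0" "f pauli_x = 0" "f pauli_z
      = 0" "f (pauli_z ** pauli_x) = 0"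
  shows "f X = 0"
proof -
  have "X = cscale ((X$1$1 + X$2$2) / 2) (mat 1) + cscale ((X$1$2 + X$2$1) / 2) pauli_x
    + cscale ((X$1$1 - X$2$2) / 2) pauli_z + cscale ((X$1$2 - X$2$1) / 2) (pauli_z ** pauli_x)"
    by (simp add: mat2_eq mat2_mult field_simps)
  then show ?thesis
    by (rule ssubst) (simp add: 0 clinear_add[OF f] clinear_cscale[OF f])
qed

lemma pauli_commutator_invertible:
  "invertible (commutator pauli_x pauli_z)" "invertible (commutator pauli_z pauli_x)"
  "invertible (commutator pauli_z (pauli_z ** pauli_x))"
  "invertible (commutator (pauli_z ** pauli_x) pauli_x)"
  "invertible (commutator (mat 1 + pauli_x) pauli_z)"
  "invertible (commutator (mat 1 + mat 1 + pauli_x) pauli_z)"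
  by (simp_all add: invertible_det_nz det_2 commutator_def mat2_mult matrix_distribs)

text \<open>Scalar matrices commute with everything, but \<open>1 = (1 + pauli_x) - pauli_x\<close> is a difference
  of two matrices to which the hypothesis applies.\<close>

lemma linear_eq_0_if_noncommuting:
  fixes f :: "complex^2^2 \<Rightarrow> complex^'n^'m"
  assumes f: "clinear f" and 0: "\<And>A A'. invertible (commutator A A') \<Longrightarrow> f A = 0"
  shows "f X = 0"
proof (rule pauli_linear_eq_0[OF f])
  show x: "f pauli_x = 0" "f pauli_z = 0" "f (pauli_z ** pauli_x) = 0"
    by (rule 0[OF pauli_commutator_invertible(1)] 0[OF pauli_commutator_invertible(2)]
      0[OF pauli_commutator_invertible(4)])+
  have "f (mat 1 + pauli_x) = 0" by (rule 0[OF pauli_commutator_invertible(5)])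
  then show "f (mat 1) = 0" by (simp add: clinear_add[OF f] x)
qed

text \<open>The choice \<open>D = 1\<close> gives \<open>X = Y\<close>, and a matrix that commutes with both Pauli matrices is
  scalar.\<close>

lemma intertwiner_scalar:
  fixes X Y :: "complex^2^2"
  assumes "\<And>D. X ** D = D ** Y"
  shows "\<exists>c. X = mat c \<and> Y = mat c"
proof -
  have XY: "Y = X" using assms[of "mat 1"] by simp
  have x: "X ** pauli_x = pauli_x ** X" and z: "X ** pauli_z = pauli_z ** X"
    using assms unfolding XY by blast+
  have "X $ 1 $ 2 = - X $ 1 $ 2" "X $ 2 $ 1 = - X $ 2 $ 1"
    using arg_cong[OF z, of "\<lambda>M. M $ 1 $ 2"] arg_cong[OF z, of "\<lambda>M. M $ 2 $ 1"]
    by (simp_all add: mat2_mult)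
  moreover have "X $ 1 $ 1 = X $ 2 $ 2"
    using arg_cong[OF x, of "\<lambda>M. M $ 1 $ 2"] by (simp add: mat2_mult)
  ultimately have "X = mat (X $ 1 $ 1)"
    by (simp add: mat2_eq equal_neg_zero)
  then show ?thesis using XY by blast
qed

lemma unit_linear_eq_0:
  fixes f :: "complex^2^2 \<Rightarrow> complex^'n^'m"
  assumes f: "clinear f" and 0: "\<And>k l. f (mat_unit k l) = 0"
  shows "f X = 0"
proof -
  have "X = cscale (X$1$1) (mat_unit 1 1) + cscale (X$1$2) (mat_unit 1 2)
    + cscale (X$2$1) (mat_unit 2 1) + cscale (X$2$2) (mat_unit 2 2)"
    by (simp add: mat2_eq)
  then show ?thesis
    by (rule ssubst) (simp add: 0 clinear_add[OF f] clinear_cscale[OF f])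
qed

text \<open>The hypothesis is the linearized rank condition in the case where only the upper left blocks
  \<open>A\<close>, \<open>A'\<close> and one further block \<open>B\<close> in the first row of the second matrix are present. It is
  evaluated at \<open>W = 2\<close> and the corresponding \<open>V\<close>, for several pairs \<open>A, A'\<close>. If these anticommute,
  the hypothesis becomes \<open>f A B = - (f A' + h B) A A'\<^sup>-\<^sup>1 B\<close>. The term with \<open>h\<close> is even in \<open>B\<close> and
  the others are odd, so \<open>h B = 0\<close> for invertible \<open>B\<close>, and \<open>f A A\<^sup>-\<^sup>1 = f A' A'\<^sup>-\<^sup>1\<close>. So \<open>f\<close> is one
  and the same left multiplication on all three traceless basis elements. The pair \<open>2 + pauli_x,
  pauli_z\<close> links this multiplication to the value of \<open>f\<close> at the identity.\<close>

lemma left_multiplication_from_tests: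
  fixes f h :: "complex^2^2 \<Rightarrow> complex^2^2"
  assumes f: "clinear f" and h: "clinear h"
    and test: "\<And>A A' B (V :: complex^2^2) (W :: complex^2^2). invertible (commutator A A') \<Longrightarrow>
      A ** (A' ** V + B ** W) = A' ** (A ** V) \<Longrightarrow> f A ** (A' ** V + B ** W) = (f A' + h B) ** (A ** V)"
  shows "f X = f (mat 1) ** X" and "h X = 0"
proof -
  have t: "f pauli_x ** B = - ((f pauli_z + h B) ** (pauli_x ** (pauli_z ** B)))" for B
    using test[of pauli_x pauli_z "- (pauli_z ** B)" B "mat 1
        + mat 1", OF pauli_commutator_invertible(1)]
    by (simp add: matrix_distribs)
  have fx: "f pauli_x = f pauli_z ** (pauli_z ** pauli_x)"
  proof -
    have 1: "f pauli_x = f pauli_z ** (pauli_z ** pauli_x) + h (mat 1) ** (pauli_z ** pauli_x)"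
      using t[of "mat 1"] by (simp add: matrix_distribs)
    have 2: "f pauli_x = f pauli_z ** (pauli_z ** pauli_x) - h (mat 1) ** (pauli_z ** pauli_x)"
      using t[of "- mat 1"] by (simp add: matrix_distribs clinear_minus[OF h] minus_equation_iff[of
          "f _"])
    from 1 2 have "f pauli_x + f pauli_x = (f pauli_z ** (pauli_z ** pauli_x)
        + h (mat 1) ** (pauli_z ** pauli_x))
      + (f pauli_z ** (pauli_z ** pauli_x) - h (mat 1) ** (pauli_z ** pauli_x))" by metis
    moreover have "(M + N) + (M - N) = M + M" for M N :: "complex^2^2" by simp
    ultimately show ?thesis by (metis double_cancel)
  qed
  have h0: "h B = 0" if B': "B ** B' = mat 1" for B B'
  proof -
    have "h B ** (pauli_z ** (pauli_x ** B)) = 0"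
      using t[of B] unfolding fx by (simp add: matrix_distribs flip: matrix_mul_assoc)
    then have "h B ** (pauli_z ** (pauli_x ** B)) ** (B' ** (pauli_x ** pauli_z)) = 0" by simp
    moreover have "B ** (B' ** M) = M" for M :: "complex^2^2"
      by (simp add: matrix_mul_assoc B')
    ultimately show ?thesis
      by (simp add: matrix_distribs del: pauli_mult(3) flip: matrix_mul_assoc)
  qed
  show h: "h X = 0" for X
  proof (rule pauli_linear_eq_0[OF h])
    show "h (mat 1) = 0" "h pauli_x = 0" "h pauli_z = 0"
      using h0[of "mat 1" "mat 1"] h0[OF pauli_mult(1)] h0[OF pauli_mult(2)] by simp_all
    have "pauli_z ** pauli_x ** (pauli_x ** pauli_z) = mat 1"
      by (simp flip: matrix_mul_assoc del: pauli_mult(3))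
    then show "h (pauli_z ** pauli_x) = 0" by (rule h0)
  qed
  show "f X = f (mat 1) ** X" for X
  proof -
    let ?e = "pauli_z ** pauli_x"
    have 2: "f pauli_z = f ?e ** pauli_x"
      using test[of pauli_z ?e ?e "mat 1" "mat 1 + mat 1", OF pauli_commutator_invertible(3)]
      by (simp add: matrix_distribs h flip: matrix_mul_assoc)
    then have fe: "f ?e = f pauli_z ** pauli_x"
      by (simp flip: matrix_mul_assoc)
    define r where "r = f (mat 1) - f pauli_z ** pauli_z"
    have f1: "f (mat 1) = f pauli_z ** pauli_z + r"
      by (simp add: r_def)
    have f_double: "f (2 * mat 1) = 2 * f (mat 1)"
      by (simp only: mult_2 clinear_add[OF f])
    \<comment> \<open>With \<open>1 + pauli_x\<close> in place of \<open>2 + pauli_x\<close> the factor of \<open>r\<close> would not be invertible.\<close>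
    have "r ** (mat 1 - pauli_x - pauli_x) + r ** (mat 1 - pauli_x - pauli_x) = 0"
      using test[of "mat 1 + mat 1 + pauli_x" pauli_z "- (pauli_z + ?e + ?e)" "mat 1" "mat 1
          + mat 1", OF pauli_commutator_invertible(6)]
      by (simp add: matrix_distribs h clinear_add[OF f] f_double fx f1 flip: matrix_mul_assoc)
    then have "r ** (mat 1 - pauli_x - pauli_x) = 0"
      by (metis double_cancel add_0)
    then have "r ** (mat 1 - pauli_x - pauli_x) ** (mat 1 + pauli_x + pauli_x) = 0"
      by simp
    moreover have "(mat 1 - pauli_x - pauli_x) ** (mat 1 + pauli_x + pauli_x) = mat (-3)"
      by (simp add: mat2_eq mat2_mult)
    ultimately have "r ** mat (-3) = 0"
      by (simp flip: matrix_mul_assoc)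
    then have "r = 0" by (simp add: mat2_eq mat2_mult)
    then have f1: "f (mat 1) = f pauli_z ** pauli_z" using f1 by simp
    let ?g = "\<lambda>X. f X - f (mat 1) ** X"
    have "?g X = 0"
    proof (rule pauli_linear_eq_0[where f = ?g])
      show "clinear ?g"
        by (intro clinearI) (simp_all add: clinear_add[OF f] clinear_cscale[OF f] matrix_distribs
          cscale_mult_right cmat.scale_right_diff_distrib)
    qed (simp_all add: f1 fx fe flip: matrix_mul_assoc)
    then show ?thesis by simp
  qed
qed

text \<open>The equation says that \<open>u D D' - D' w D\<close> is symmetric in \<open>D\<close> and \<open>D'\<close>. Written out for all
  pairs of matrix units it is a linear system for the entries of \<open>u\<close> and \<open>w\<close>. In the claimed
  solution the entries of \<open>z\<close> can be read off from off-diagonal entries of \<open>w\<close>, to which scalars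
  do not contribute; this gives the definition of \<open>z\<close> in the proof, and the system confirms it.\<close>

lemma antisymmetric_pair:
  fixes u w :: "complex^2^2 \<Rightarrow> complex^2^2"
  assumes u: "clinear u" and w: "clinear w"
    and eq: "\<And>D D'. u D ** D' - D' ** w D = u D' ** D - D ** w D'"
  shows "\<exists>z. \<forall>D. \<exists>c. u D = mat c - D ** z \<and> w D = mat c + z ** D"
proof -
  let ?E = "mat_unit :: 2 \<Rightarrow> 2 \<Rightarrow> complex^2^2"
  define z :: "complex^2^2" where
    "z = vector [vector [w (?E 1 2) $ 1 $ 2, w (?E 2 2) $ 1 $ 2],
                 vector [w (?E 1 1) $ 2 $ 1, w (?E 2 1) $ 2 $ 1]]"
  have z [simp]: "z $ 1 $ 1 = w (?E 1 2) $ 1 $ 2" "z $ 1 $ 2 = w (?E 2 2) $ 1 $ 2"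
     "z $ 2 $ 1 = w (?E 1 1) $ 2 $ 1" "z $ 2 $ 2 = w (?E 2 1) $ 2 $ 1" by (simp_all add: z_def)
  note units = eq[of "?E 1 1" "?E 1 2"] eq[of "?E 1 1" "?E 2 1"] eq[of "?E 1 1" "?E 2 2"]
    eq[of "?E 1 2" "?E 2 1"] eq[of "?E 1 2" "?E 2 2"] eq[of "?E 2 1" "?E 2 2"]
  note comps = units[unfolded mat2_eq]
  define g where "g D = w D - z ** D" for D
  define k where "k D = u D + D ** z - g D" for D
  define d where "d D = (g D - mat (g D $ 1 $ 1))" for D
  have g: "clinear g" unfolding g_def
    by (intro clinearI) (simp_all add: clinear_add[OF w] clinear_cscale[OF w] matrix_distribs
          cscale_mult_right cmat.scale_right_diff_distrib)
  have k: "clinear k" unfolding k_def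
    by (intro clinearI) (simp_all add: clinear_add[OF g] clinear_cscale[OF g] clinear_add[OF u]
        clinear_cscale[OF u] matrix_distribs
          cscale_mult_left cmat.scale_right_diff_distrib cmat.scale_right_distrib)
  have d: "clinear d" unfolding d_def
    by (intro clinearI) (simp_all add: clinear_add[OF g] clinear_cscale[OF g] mat2_eq algebra_simps)
  have "d X = 0" for X
  proof (rule unit_linear_eq_0[OF d])
    fix a b :: 2
    show "d (?E a b) = 0"
      using exhaust_2[of a] exhaust_2[of b] comps
      unfolding mat2_eq d_def g_def by (auto simp: mat2_mult complex_eq_iff)
  qed
  moreover have "k X = 0" for X
  proof (rule unit_linear_eq_0[OF k])
    fix a b :: 2
    show "k (?E a b) = 0"
      using exhaust_2[of a] exhaust_2[of b] comps
      unfolding mat2_eq k_def g_def by (auto simp: mat2_mult complex_eq_iff)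
  qed
  ultimately have "u D = mat (g D $ 1 $ 1) - D ** z \<and> w D = mat (g D $ 1 $ 1) + z ** D" for D
    unfolding d_def k_def g_def by (metis add.commute add_diff_cancel diff_add_cancel
        eq_iff_diff_eq_0)
  then show ?thesis by blast
qed

section \<open>The algebra and its commutators\<close>

definition flag_matrix ::
    "complex^2^2 \<Rightarrow> complex^2^2 \<Rightarrow> complex^2^2 \<Rightarrow> complex^2^2 \<Rightarrow> complex \<Rightarrow> complex^6^6" where
  "flag_matrix A B C D c = block_matrix
     (vector [vector [A, B, C], vector [0, mat c, D], vector [0, 0, mat c]])"

lemma \<A>_eq: "\<A> = {flag_matrix A B C D c | A B C D c. True}"
  unfolding \<A>_def flag_matrix_def by blast

lemma flag_matrix_in_\<A> [simp]: "flag_matrix A B C D c \<in> \<A>"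
  unfolding \<A>_eq by blast

lemma block_flag_matrix [simp]:
  "block 1 1 (flag_matrix A B C D c) = A" "block 1 2 (flag_matrix A B C D c) = B"
  "block 1 3 (flag_matrix A B C D c) = C" "block 2 1 (flag_matrix A B C D c) = 0"
  "block 2 2 (flag_matrix A B C D c) = mat c" "block 2 3 (flag_matrix A B C D c) = D"
  "block 3 1 (flag_matrix A B C D c) = 0" "block 3 2 (flag_matrix A B C D c) = 0"
  "block 3 3 (flag_matrix A B C D c) = mat c"
  by (simp_all add: flag_matrix_def)

lemma in_\<A>_iff:
  "M \<in> \<A> \<longleftrightarrow> block 2 1 M = 0 \<and> block 3 1 M = 0 \<and> block 3 2 M = 0 \<and>
     (\<exists>c. block 2 2 M = mat c \<and> block 3 3 M = mat c)" (is "_ \<longleftrightarrow> ?R")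
proof
  assume ?R
  then obtain c where c: "block 2 2 M = mat c" "block 3 3 M = mat c" by blast
  have "block k l M = block k l (flag_matrix (block 1 1 M) (block 1 2 M) (block 1 3 M) (block 2 3 M)
      c)" for k l
    using \<open>?R\<close> c exhaust_3[of k] exhaust_3[of l] by auto
  then show "M \<in> \<A>" using block_eqI flag_matrix_in_\<A> by metis
qed (auto simp: \<A>_eq)

lemma flag_matrix_add:
  "flag_matrix A B C D c + flag_matrix A' B' C' D' c' =
     flag_matrix (A + A') (B + B') (C + C') (D + D') (c + c')"
proof (rule block_eqI)
  fix k l show "block k l (flag_matrix A B C D c + flag_matrix A' B' C' D' c') =
     block k l (flag_matrix (A + A') (B + B') (C + C') (D + D') (c + c'))"
    using exhaust_3[of k] exhaust_3[of l] by (auto simp: block_add mat_def vec_eq_iff)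
qed

lemma flag_matrix_cscale:
  "cscale t (flag_matrix A B C D c) =
     flag_matrix (cscale t A) (cscale t B) (cscale t C) (cscale t D) (t * c)"
proof (rule block_eqI)
  fix k l show "block k l (cscale t (flag_matrix A B C D c)) =
     block k l (flag_matrix (cscale t A) (cscale t B) (cscale t C) (cscale t D) (t * c))"
    using exhaust_3[of k] exhaust_3[of l] by (auto simp: block_cscale mat_def vec_eq_iff)
qed

definition lower_block_matrix :: "complex^2^2 \<Rightarrow> complex^2^2 \<Rightarrow> complex^2^2 \<Rightarrow> complex^6^6" where
  "lower_block_matrix y21 y31 y32 = block_matrix (vector [vector [0, 0, 0], vector [y21, 0, 0],
      vector [y31, y32, 0]])"

lemma rank_le_2_if_lower_rows_zero:
  fixes M :: "complex^6^6"
  assumes "\<And>i. i \<noteq> 1 \<Longrightarrow> i \<noteq> 2 \<Longrightarrow> row i M = 0"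
  shows "rank M \<le> 2"
proof -
  have "rows M \<subseteq> vec.span {row 1 M, row 2 M}"
    using assms by (auto simp: rows_def intro: vec.span_base) (metis insert_iff vec.span_base
        vec.span_zero)
  then have "rank M \<le> card {row 1 M, row 2 M}"
    unfolding row_rank_def_gen by (intro vec.dim_le_card) auto
  also have "\<dots> \<le> 2" by (simp add: card_insert_le_m1)
  finally show ?thesis .
qed

text \<open>Modulo the first block row only \<open>D\<close> and the scalar survive, and matrices of this shape
  commute.\<close>

lemma lower_blocks_commutator_\<A>:
  assumes "S \<in> \<A>" "T \<in> \<A>" and "k \<noteq> 1"
  shows "block k l (commutator S T) = 0"
proof -
  obtain A B C D s A' B' C' D' t where ST: "S = flag_matrix A B C D s" "T = flag_matrix A' B' C' D' t"
    using assms unfolding \<A>_eq by blast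
  show ?thesis
    using \<open>k \<noteq> 1\<close> exhaust_3[of k] exhaust_3[of l]
    by (auto simp: ST commutator_def block_diff block_mult scalar_mat_commute[of D]
        scalar_mat_commute[of D']
      scalar_mat_commute[of "mat s" t])
qed

lemma rank_commutator_\<A>:
  assumes "S \<in> \<A>" "T \<in> \<A>"
  shows "rank (commutator S T) \<le> 2"
proof (rule rank_le_2_if_lower_rows_zero)
  fix i :: 6 assume i: "i \<noteq> 1" "i \<noteq> 2"
  then have "block_of i \<noteq> 1" by (simp add: block_of_def)
  then show "row i (commutator S T) = 0"
    by (simp add: row_def vec_eq_iff entry_block[of _ i] lower_blocks_commutator_\<A>[OF assms])
qed

section \<open>Solutions of the linearized rank condition\<close>

text \<open>The linearized rank condition, restricted to pairs \<open>S, T\<close> whose upper left blocks have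
  invertible commutator: a matrix \<open>V\<close> with columns in the kernel of \<open>[S, T]\<close> must be mapped into
  the span of the first two basis vectors, which is the image of \<open>[S, T]\<close>. Only the values of \<open>\<phi>\<close>
  on \<open>\<A>\<close> modulo \<open>\<A>\<close> are constrained.\<close>

locale first_order_solution =
  fixes \<phi> :: "complex^6^6 \<Rightarrow> complex^6^6"
  assumes linear: "clinear \<phi>"
    and commutator_condition:
      "\<And>S T V k. S \<in> \<A> \<Longrightarrow> T \<in> \<A> \<Longrightarrow> invertible (block 1 1 (commutator S T)) \<Longrightarrow>
         commutator S T ** (V :: complex^2^6) = 0 \<Longrightarrow> k \<noteq> 1 \<Longrightarrow>
         row_block k ((commutator (\<phi> S) T + commutator S (\<phi> T)) ** V) = 0"
begin

text \<open>The blocks of \<open>\<phi>\<close> as functions of the four free blocks of its argument. The scalar parameter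
  is treated separately, through the value at the identity matrix.\<close>

definition \<phi>\<^sub>A :: "3 \<Rightarrow> 3 \<Rightarrow> complex^2^2 \<Rightarrow> complex^2^2" where "\<phi>\<^sub>A k l X
    = block k l (\<phi> (flag_matrix X 0 0 0 0))"
definition \<phi>\<^sub>B :: "3 \<Rightarrow> 3 \<Rightarrow> complex^2^2 \<Rightarrow> complex^2^2" where "\<phi>\<^sub>B k l X
    = block k l (\<phi> (flag_matrix 0 X 0 0 0))"
definition \<phi>\<^sub>C :: "3 \<Rightarrow> 3 \<Rightarrow> complex^2^2 \<Rightarrow> complex^2^2" where "\<phi>\<^sub>C k l X
    = block k l (\<phi> (flag_matrix 0 0 X 0 0))"
definition \<phi>\<^sub>D :: "3 \<Rightarrow> 3 \<Rightarrow> complex^2^2 \<Rightarrow> complex^2^2" where "\<phi>\<^sub>D k l X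
    = block k l (\<phi> (flag_matrix 0 0 0 X 0))"

lemma clinear_parts: "clinear (\<phi>\<^sub>A k l)" "clinear (\<phi>\<^sub>B k l)" "clinear (\<phi>\<^sub>C k l)" "clinear (\<phi>\<^sub>D k l)"
proof -
  note * = clinear_add[OF linear, symmetric] clinear_cscale[OF linear, symmetric]
    flag_matrix_add flag_matrix_cscale block_add[symmetric] block_cscale[symmetric]
  show "clinear (\<phi>\<^sub>A k l)" "clinear (\<phi>\<^sub>B k l)" "clinear (\<phi>\<^sub>C k l)" "clinear (\<phi>\<^sub>D k l)"
    by (rule clinearI; simp add: \<phi>\<^sub>A_def \<phi>\<^sub>B_def \<phi>\<^sub>C_def \<phi>\<^sub>D_def *)+
qed

lemmas part_zero [simp] = clinear_parts[THEN clinear_zero]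

lemma block_\<phi>: "block k l (\<phi> (flag_matrix A B C D 0)) = \<phi>\<^sub>A k l A + \<phi>\<^sub>B k l B + \<phi>\<^sub>C k l C + \<phi>\<^sub>D k l D"
  by (simp add: \<phi>\<^sub>A_def \<phi>\<^sub>B_def \<phi>\<^sub>C_def \<phi>\<^sub>D_def block_add[symmetric] clinear_add[OF linear, symmetric]
      flag_matrix_add)

lemma commutator_flag_matrix:
  "block 1 1 (commutator (flag_matrix A B C D s) (flag_matrix A' B' C' D' t)) = commutator A A'"
  by (simp add: commutator_def block_mult block_diff)

lemma flag_kernel:
  fixes A B C D A' B' C' D' U V W :: "complex^2^2"
  assumes "A ** (A' ** U + B' ** V + C' ** W) + B ** (D' ** W) =
     A' ** (A ** U + B ** V + C ** W) + B' ** (D ** W)"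
  shows "commutator (flag_matrix A B C D 0) (flag_matrix A' B' C' D' 0) ** stack U V W = 0"
proof (rule row_block_eqI)
  fix k show "row_block k (commutator (flag_matrix A B C D 0) (flag_matrix A' B' C' D' 0) ** stack U
      V W) = row_block k 0"
    using exhaust_3[of k] assms
    by (auto simp: commutator_def row_block_zero matrix_diff_rdistrib row_block_diff row_block_mult
        algebra_simps
      simp flip: matrix_mul_assoc)
qed

text \<open>The first equation is the third block row of the linearized condition, the second one is the
  second block row. As \<open>\<A>\<close> is block triangular, the rows below the first of \<open>[S, \<phi> T] V\<close> and \<open>[\<phi>
  S, T] V\<close> involve only \<open>V\<close>, \<open>S V\<close>, \<open>T V\<close> and the blocks of \<open>\<phi>\<close> in the second and third rows; the
  scalar parameters are zero here. The assumption \<open>ker\<close> is the first block row of \<open>[S, T] V = 0\<close>.\<close>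

lemma commutator_test:
  fixes A B C D A' B' C' D' U V W :: "complex^2^2"
  assumes inv: "invertible (commutator A A')"
    and ker: "A ** (A' ** U + B' ** V + C' ** W) + B ** (D' ** W) =
     A' ** (A ** U + B ** V + C ** W) + B' ** (D ** W)"
  defines "P \<equiv> \<lambda>k l. \<phi>\<^sub>A k l A + \<phi>\<^sub>B k l B + \<phi>\<^sub>C k l C + \<phi>\<^sub>D k l D"
    and "P' \<equiv> \<lambda>k l. \<phi>\<^sub>A k l A' + \<phi>\<^sub>B k l B' + \<phi>\<^sub>C k l C' + \<phi>\<^sub>D k l D'"
  shows "P 3 1 ** (A' ** U + B' ** V + C' ** W) + P 3 2 ** (D' ** W)
      = P' 3 1 ** (A ** U + B ** V + C ** W) + P' 3 2 ** (D ** W)" (is ?bottom)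
    and "P 2 1 ** (A' ** U + B' ** V + C' ** W) + P 2 2 ** (D' ** W)
        - D' ** (P 3 1 ** U + P 3 2 ** V + P 3 3 ** W)
      = P' 2 1 ** (A ** U + B ** V + C ** W) + P' 2 2 ** (D ** W)
        - D ** (P' 3 1 ** U + P' 3 2 ** V + P' 3 3 ** W)" (is ?middle)
proof -
  let ?S = "flag_matrix A B C D 0" and ?T = "flag_matrix A' B' C' D' 0"
  have *: "row_block k ((commutator (\<phi> ?S) ?T + commutator ?S (\<phi> ?T)) ** stack U V W)
      = 0" if "k \<noteq> 1" for k
    by (rule commutator_condition)
      (use that inv flag_kernel[OF ker] in \<open>simp_all add: commutator_flag_matrix\<close>)
  have P: "block k l (\<phi> ?S) = P k l" "block k l (\<phi> ?T) = P' k l" for k l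
    by (simp_all add: P_def P'_def block_\<phi>)
  note expand = commutator_def matrix_add_rdistrib matrix_diff_rdistrib row_block_add row_block_diff
    row_block_mult P matrix_mul_assoc[symmetric]
  show ?bottom
    using *[of 3] by (simp add: expand) (simp add: algebra_simps)
  show ?middle
    using *[of 2] by (simp add: expand) (simp add: algebra_simps)
qed

definition \<phi>\<^sub>I :: "3 \<Rightarrow> 3 \<Rightarrow> complex^2^2" where "\<phi>\<^sub>I k l = block k l (\<phi> (flag_matrix (mat 1) 0 0 0 1))"

text \<open>The condition for the pairs \<open>S, T\<close> and \<open>S + 1, T\<close> with the same \<open>V\<close>: the commutator does not
  change, so subtracting leaves a condition on \<open>[\<phi> 1, T]\<close> alone.\<close>

lemma identity_test:
  fixes A B C D A' B' C' D' U V W :: "complex^2^2"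
  assumes inv: "invertible (commutator A A')"
    and ker: "A ** (A' ** U + B' ** V + C' ** W) + B ** (D' ** W) =
     A' ** (A ** U + B ** V + C ** W) + B' ** (D ** W)"
  shows "\<phi>\<^sub>I 3 1 ** (A' ** U + B' ** V + C' ** W) + \<phi>\<^sub>I 3 2 ** (D' ** W) = 0" (is ?bottom)
    and "\<phi>\<^sub>I 2 1 ** (A' ** U + B' ** V + C' ** W) + \<phi>\<^sub>I 2 2 ** (D' ** W)
        = D' ** (\<phi>\<^sub>I 3 1 ** U + \<phi>\<^sub>I 3 2 ** V + \<phi>\<^sub>I 3 3 ** W)" (is ?middle)
proof -
  let ?S = "flag_matrix A B C D 0" and ?T = "flag_matrix A' B' C' D' 0" and ?I
      = "flag_matrix (mat 1) 0 0 0 1"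
  let ?V = "stack U V W"
  have I: "?I = mat 1"
  proof (rule block_eqI)
    fix k l show "block k l ?I = block k l (mat 1)"
      using exhaust_3[of k] exhaust_3[of l] by (auto simp: block_mat)
  qed
  have comm: "commutator (?S + ?I) ?T = commutator ?S ?T"
    by (simp add: commutator_def I matrix_distribs)
  have 1: "row_block k ((commutator (\<phi> ?S) ?T + commutator ?S (\<phi> ?T)) ** ?V) = 0" if "k \<noteq> 1" for k
    by (rule commutator_condition)
      (use that inv flag_kernel[OF ker] in \<open>simp_all add: commutator_flag_matrix\<close>)
  have 2: "row_block k ((commutator (\<phi> (?S + ?I)) ?T + commutator (?S + ?I) (\<phi> ?T)) ** ?V)
      = 0" if "k \<noteq> 1" for k
    by (rule commutator_condition, unfold comm)
      (use that inv flag_kernel[OF ker] in \<open>simp_all add: commutator_flag_matrix flag_matrix_add\<close>)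
  have "(commutator (\<phi> (?S + ?I)) ?T + commutator (?S + ?I) (\<phi> ?T)) ** ?V
     = (commutator (\<phi> ?S) ?T + commutator ?S (\<phi> ?T)) ** ?V + commutator (\<phi> ?I) ?T ** ?V"
    unfolding clinear_add[OF linear] by (simp add: commutator_def I matrix_distribs)
  then have *: "row_block k (commutator (\<phi> ?I) ?T ** ?V) = 0" if "k \<noteq> 1" for k
    using 1[OF that] 2[OF that] by (simp add: row_block_add)
  note expand = commutator_def matrix_add_rdistrib matrix_diff_rdistrib row_block_add row_block_diff
    row_block_mult \<phi>\<^sub>I_def[symmetric] matrix_mul_assoc[symmetric]
  show ?bottom
    using *[of 3] by (simp add: expand)
  show ?middle
    using *[of 2] by (simp add: expand)
qed

text \<open>The first block column of \<open>\<phi>\<close>, from tests in which the second matrix has one additional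
  block \<open>B\<close> or \<open>C\<close> in its first row.\<close>

lemma left_column:
  assumes "k \<noteq> 1"
  shows "\<phi>\<^sub>A k 1 X = \<phi>\<^sub>A k 1 (mat 1) ** X" and "\<phi>\<^sub>B k 1 X = 0" and "\<phi>\<^sub>C k 1 X = 0"
proof -
  have k: "k = 2 \<or> k = 3" using assms exhaust_3[of k] by auto
  have 1: "\<phi>\<^sub>A k 1 A ** (A' ** V + B ** W) = (\<phi>\<^sub>A k 1 A' + \<phi>\<^sub>B k 1 B) ** (A ** V)"
    if inv: "invertible (commutator A A')" and ker: "A ** (A' ** V + B ** W) = A' ** (A ** V)"
    for A A' B V W :: "complex^2^2"
    using k commutator_test[where A=A and A'=A' and B'=B and U=V and V=W and B=0 and C=0 and D=0
        and C'=0 and D'=0 and W=0, OF inv] ker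
    by auto
  have 2: "\<phi>\<^sub>A k 1 A ** (A' ** V + C ** W) = (\<phi>\<^sub>A k 1 A' + \<phi>\<^sub>C k 1 C) ** (A ** V)"
    if inv: "invertible (commutator A A')" and ker: "A ** (A' ** V + C ** W) = A' ** (A ** V)"
    for A A' C V W :: "complex^2^2"
    using k commutator_test[where A=A and A'=A' and C'=C and U=V and W=W and B=0 and C=0 and D=0
        and B'=0 and D'=0 and V=0, OF inv] ker
    by auto
  show "\<phi>\<^sub>A k 1 X = \<phi>\<^sub>A k 1 (mat 1) ** X" "\<phi>\<^sub>B k 1 X = 0"
    by (rule left_multiplication_from_tests[OF clinear_parts(1,2) 1]; assumption)+
  show "\<phi>\<^sub>C k 1 X = 0"
    by (rule left_multiplication_from_tests[OF clinear_parts(1,3) 2]; assumption)+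
qed

text \<open>Two of the three blocks of the matrix \<open>x\<close> with \<open>\<phi> S = [x, S]\<close> modulo \<open>\<A>\<close>; the third is found
  only at the end, from the dependence on \<open>D\<close>.\<close>

definition x21 :: "complex^2^2" where "x21 = \<phi>\<^sub>A 2 1 (mat 1)"
definition x31 :: "complex^2^2" where "x31 = \<phi>\<^sub>A 3 1 (mat 1)"

lemma a21: "\<phi>\<^sub>A 2 1 X = x21 ** X" and a31: "\<phi>\<^sub>A 3 1 X = x31 ** X"
  and b21 [simp]: "\<phi>\<^sub>B 2 1 X = 0" and b31 [simp]: "\<phi>\<^sub>B 3 1 X = 0"
  and c21 [simp]: "\<phi>\<^sub>C 2 1 X = 0" and c31 [simp]: "\<phi>\<^sub>C 3 1 X = 0"
  unfolding x21_def x31_def by (rule left_column; simp)+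

text \<open>With \<open>D'\<close> as the only additional block, the last block of coordinates lies in the kernel of
  the commutator, and \<open>U = V = 0\<close> is possible.\<close>

lemma a32 [simp]: "\<phi>\<^sub>A 3 2 X = 0" and a_diagonal: "\<phi>\<^sub>A 2 2 X ** D = D ** \<phi>\<^sub>A 3 3 X"
proof -
  have 1: "\<phi>\<^sub>A 3 2 A = 0" if inv: "invertible (commutator A A')" for A A'
    using commutator_test(1)[where A=A and A'=A' and D'="mat 1" and U=0 and V=0 and W="mat 1"
        and B=0 and C=0 and D=0 and B'=0 and C'=0, OF inv]
    by simp
  show "\<phi>\<^sub>A 3 2 X = 0" for X
    by (rule linear_eq_0_if_noncommuting[OF clinear_parts(1) 1])
  have 2: "\<phi>\<^sub>A 2 2 A ** D - D ** \<phi>\<^sub>A 3 3 A = 0" if inv: "invertible (commutator A A')" for A A'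
    using commutator_test(2)[where A=A and A'=A' and D'=D and U=0 and V=0 and W="mat 1" and B=0
        and C=0 and D=0 and B'=0 and C'=0, OF inv]
    by simp
  have "clinear (\<lambda>A. \<phi>\<^sub>A 2 2 A ** D - D ** \<phi>\<^sub>A 3 3 A)"
    by (intro clinearI) (simp_all add: clinear_add[OF clinear_parts(1)] clinear_cscale[OF
        clinear_parts(1)] matrix_distribs
          cscale_mult_left cscale_mult_right cmat.scale_right_diff_distrib)
  from linear_eq_0_if_noncommuting[OF this 2] show "\<phi>\<^sub>A 2 2 X ** D = D ** \<phi>\<^sub>A 3 3 X" by simp
qed

text \<open>In the remaining tests the upper left blocks are \<open>pauli_x\<close> and \<open>pauli_z\<close>. One of \<open>V\<close>, \<open>W\<close> is
  \<open>0\<close> and the other is \<open>1\<close> or \<open>2\<close>; then \<open>U\<close> is determined by the kernel equation. To find the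
  dependence of \<open>\<phi>\<close> on \<open>B\<close>, \<open>C\<close> or \<open>D\<close> the first matrix gets that block and the second one an
  independent block \<open>D'\<close>.\<close>

lemmas pauli_inv = pauli_commutator_invertible(1)

lemma d31 [simp]: "\<phi>\<^sub>D 3 1 X = 0"
  using commutator_test(1)[where A=pauli_x and A'=pauli_z and D'=X and B="mat 1" and U="- pauli_x"
      and V="mat 1 + mat 1" and W=0
      and C=0 and D=0 and B'=0 and C'=0, OF pauli_inv]
  by (simp add: a31 matrix_distribs flip: matrix_mul_assoc)

lemma d21_b32: "\<phi>\<^sub>D 2 1 D ** B + D ** (\<phi>\<^sub>B 3 2 B + \<phi>\<^sub>B 3 2 B) = D ** x31 ** B"
  using commutator_test(2)[where A=pauli_x and A'=pauli_z and D'=D and B=B and U="- (pauli_x ** B)"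
      and V="mat 1 + mat 1" and W=0
      and C=0 and D=0 and B'=0 and C'=0, OF pauli_inv]
  by (simp add: a31 a21 matrix_distribs flip: matrix_mul_assoc) (simp add: algebra_simps)

lemma b32: "\<phi>\<^sub>B 3 2 B = x31 ** B"
  using commutator_test(1)[where A=pauli_x and A'=pauli_z and D'="mat 1" and B=B
      and U="pauli_x ** (pauli_z ** B)" and W="mat 1 + mat 1" and V=0
      and C=0 and D=0 and B'=0 and C'=0, OF pauli_inv]
  by (simp add: a31 a21 matrix_distribs two_cancel two_eq_0 flip: matrix_mul_assoc)

lemma d21: "\<phi>\<^sub>D 2 1 D = - (D ** x31)"
proof -
  have "\<phi>\<^sub>D 2 1 D + 2 * (D ** x31) = D ** x31"
    using d21_b32[of D "mat 1"] by (simp add: b32 matrix_distribs)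
  then have "\<phi>\<^sub>D 2 1 D = D ** x31 - 2 * (D ** x31)" by (simp only: eq_diff_eq)
  then show ?thesis by simp
qed

lemma b_diagonal: "(\<phi>\<^sub>B 2 2 B - x21 ** B) ** D = D ** \<phi>\<^sub>B 3 3 B"
  using commutator_test(2)[where A=pauli_x and A'=pauli_z and D'=D and B=B
      and U="pauli_x ** (pauli_z ** (B ** D))" and W="mat 1 + mat 1" and V=0
      and C=0 and D=0 and B'=0 and C'=0, OF pauli_inv]
  by (simp add: a31 a21 d21 a_diagonal matrix_distribs flip: matrix_mul_assoc, simp add:
      algebra_simps)
    (simp only: two_cancel flip: distrib_left)

lemma c32 [simp]: "\<phi>\<^sub>C 3 2 C = 0"
  using commutator_test(1)[where A=pauli_x and A'=pauli_z and D'="mat 1" and C=C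
      and U="- (pauli_x ** C)" and W="mat 1 + mat 1" and V=0
      and B=0 and D=0 and B'=0 and C'=0, OF pauli_inv]
  by (simp add: a31 a21 matrix_distribs two_cancel two_eq_0 flip: matrix_mul_assoc)

lemma c_diagonal: "\<phi>\<^sub>C 2 2 C ** D = D ** (\<phi>\<^sub>C 3 3 C - x31 ** C)"
  using commutator_test(2)[where A=pauli_x and A'=pauli_z and D'=D and C=C and U="- (pauli_x ** C)"
      and W="mat 1 + mat 1" and V=0
      and B=0 and D=0 and B'=0 and C'=0, OF pauli_inv]
  by (simp add: a31 a21 d21 a_diagonal matrix_distribs flip: matrix_mul_assoc, simp add:
      algebra_simps)
    (simp only: two_cancel flip: distrib_left)

lemma d32 [simp]: "\<phi>\<^sub>D 3 2 D = 0"
proof -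
  have 1: "\<phi>\<^sub>D 3 2 D ** D' = \<phi>\<^sub>D 3 2 D' ** D" for D D'
  using commutator_test(1)[where A=pauli_x and A'=pauli_z and D'=D' and D=D and U=0 and V=0
      and W="mat 1"
      and B=0 and C=0 and B'=0 and C'=0, OF pauli_inv] by simp
  have 2: "\<phi>\<^sub>D 3 2 D = \<phi>\<^sub>D 3 2 (mat 1) ** D" for D using 1[of D "mat 1"] by simp
  have "\<phi>\<^sub>D 3 2 (mat 1) ** (pauli_x ** pauli_z) = \<phi>\<^sub>D 3 2 (mat 1) ** (pauli_z ** pauli_x)"
    using 1[of pauli_x pauli_z] 2[of pauli_x] 2[of pauli_z]
        by (simp only: matrix_mul_assoc[symmetric])
  then have "\<phi>\<^sub>D 3 2 (mat 1) ** (pauli_z ** pauli_x) = 0"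
    by (simp add: matrix_distribs two_eq_0 neg_eq_iff_add_eq_0)
  then have "\<phi>\<^sub>D 3 2 (mat 1) ** (pauli_z ** pauli_x) ** (pauli_x ** pauli_z) = 0"
    by (simp only: times0_left)
  then have "\<phi>\<^sub>D 3 2 (mat 1) = 0" by (simp del: pauli_mult(3) flip: matrix_mul_assoc)
  then show ?thesis using 2[of D] by simp
qed

text \<open>Here both matrices have a block \<open>D\<close>, as in the proof of \<open>d32\<close>. The result is the system
  solved by \<open>antisymmetric_pair\<close>, which supplies the third block \<open>x32\<close>.\<close>

lemma d_diagonal: "\<phi>\<^sub>D 2 2 D ** D' - D' ** \<phi>\<^sub>D 3 3 D = \<phi>\<^sub>D 2 2 D' ** D - D ** \<phi>\<^sub>D 3 3 D'"
  using commutator_test(2)[where A=pauli_x and A'=pauli_z and D'=D' and D=D and U=0 and V=0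
      and W="mat 1"
      and B=0 and C=0 and B'=0 and C'=0, OF pauli_inv]
  by (simp add: a_diagonal matrix_distribs)

lemma \<phi>_identity_lower: "\<phi>\<^sub>I 2 1 = 0" "\<phi>\<^sub>I 3 1 = 0" "\<phi>\<^sub>I 3 2 = 0" and \<phi>_identity_diagonal: "\<phi>\<^sub>I 2 2 ** D
    = D ** \<phi>\<^sub>I 3 3"
proof -
  note t = identity_test[where A=pauli_x and A'=pauli_z and B'="mat 1" and U="- pauli_z"
      and V="mat 1 + mat 1" and W=0
      and B=0 and C=0 and D=0 and D'=0 and C'=0, OF pauli_inv]
  show 31: "\<phi>\<^sub>I 3 1 = 0" and "\<phi>\<^sub>I 2 1 = 0" using t by (simp_all add: matrix_distribs)
  have t: "\<phi>\<^sub>I 3 2 ** D = 0" "\<phi>\<^sub>I 2 2 ** D = D ** \<phi>\<^sub>I 3 3" for D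
    using identity_test[where A=pauli_x and A'=pauli_z and D'=D and U=0 and V=0 and W="mat 1"
      and B=0 and C=0 and D=0 and B'=0 and C'=0, OF pauli_inv] by simp_all
  show "\<phi>\<^sub>I 3 2 = 0" using t(1)[of "mat 1"] by simp
  show "\<phi>\<^sub>I 2 2 ** D = D ** \<phi>\<^sub>I 3 3" by (rule t(2))
qed

lemma \<phi>_flag_matrix:
  "block k l (\<phi> (flag_matrix A B C D s)) = \<phi>\<^sub>A k l (A - mat s) + \<phi>\<^sub>B k l B + \<phi>\<^sub>C k l C + \<phi>\<^sub>D k l D
      + cscale s (\<phi>\<^sub>I k l)"
proof -
  have "A - mat s + cscale s (mat 1) = A" by (simp add: mat2_eq)
  then have "flag_matrix A B C D s = flag_matrix (A - mat s) B C D 0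
      + cscale s (flag_matrix (mat 1) 0 0 0 1)"
    unfolding flag_matrix_cscale flag_matrix_add by simp
  then show ?thesis
    by (simp add: clinear_add[OF linear] clinear_cscale[OF linear] block_add block_cscale block_\<phi>
        \<phi>\<^sub>I_def)
qed

text \<open>Collects the formulas for the blocks of \<open>\<phi>\<close>. Each of the five parameters of \<open>S\<close> contributes
  its own scalar to the second and third diagonal blocks of the difference, equally in both, so
  the difference lies in \<open>\<A>\<close>.\<close>

lemma \<phi>_is_inner:
  "\<exists>y21 y31 y32. \<forall>S\<in>\<A>.
     \<phi> S - commutator (lower_block_matrix y21 y31 y32) S \<in> \<A>"
proof -
  obtain x32 where x32: "\<And>D. \<exists>m. \<phi>\<^sub>D 2 2 D = mat m - D ** x32 \<and> \<phi>\<^sub>D 3 3 D = mat m + x32 ** D"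
    using antisymmetric_pair[OF clinear_parts(4) clinear_parts(4) d_diagonal] by blast
  let ?x = "lower_block_matrix x21 x31 x32"
  have "\<phi> S - commutator ?x S \<in> \<A>" if "S \<in> \<A>" for S
  proof -
    obtain A B C D s where S: "S = flag_matrix A B C D s"
      using \<open>S \<in> \<A>\<close> unfolding \<A>_eq by blast
    obtain ma where ma: "\<phi>\<^sub>A 2 2 (A - mat s) = mat ma" "\<phi>\<^sub>A 3 3 (A - mat s) = mat ma"
      using intertwiner_scalar[of "\<phi>\<^sub>A 2 2 (A - mat s)" "\<phi>\<^sub>A 3 3 (A - mat s)"] a_diagonal by blast
    obtain mb where "\<phi>\<^sub>B 2 2 B - x21 ** B = mat mb" and mb: "\<phi>\<^sub>B 3 3 B = mat mb"
      using intertwiner_scalar[of "\<phi>\<^sub>B 2 2 B - x21 ** B" "\<phi>\<^sub>B 3 3 B"] b_diagonal by blast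
    then have mb': "\<phi>\<^sub>B 2 2 B = mat mb + x21 ** B" by (simp add: algebra_simps)
    obtain mc where mc: "\<phi>\<^sub>C 2 2 C = mat mc" and "\<phi>\<^sub>C 3 3 C - x31 ** C = mat mc"
      using intertwiner_scalar[of "\<phi>\<^sub>C 2 2 C" "\<phi>\<^sub>C 3 3 C - x31 ** C"] c_diagonal by blast
    then have mc': "\<phi>\<^sub>C 3 3 C = mat mc + x31 ** C" by (simp add: algebra_simps)
    obtain md where md: "\<phi>\<^sub>D 2 2 D = mat md - D ** x32" "\<phi>\<^sub>D 3 3 D = mat md + x32 ** D" using x32
        by blast
    obtain mj where mj: "\<phi>\<^sub>I 2 2 = mat mj" "\<phi>\<^sub>I 3 3 = mat mj"
      using intertwiner_scalar[of "\<phi>\<^sub>I 2 2" "\<phi>\<^sub>I 3 3"] \<phi>_identity_diagonal by blast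
    have "mat ma + mat mb + mat mc + mat md + cscale s (mat mj) = (mat (ma + mb + mc + md
        + s * mj) :: complex^2^2)"
      by (simp add: mat2_eq)
    then have m: "mat (ma + mb + mc + md + s * mj) = mat ma + mat mb + mat mc + mat md
        + cscale s (mat mj :: complex^2^2)"
      by (rule sym)
    note scalar = scalar_mat_commute[where s = s]
    note blocks = S block_diff commutator_def block_mult \<phi>_flag_matrix a21 a31 b32 d21
        \<phi>_identity_lower
         ma mb mb' mc mc' md mj m scalar lower_block_matrix_def
    show ?thesis
      unfolding in_\<A>_iff
      by (intro conjI exI[of _ "ma + mb + mc + md + s * mj"]; simp add: blocks)
        (simp_all add: matrix_distribs scalar)
  qed
  then show ?thesis by blast
qed

end

section \<open>Coordinates adapted to the algebra\<close>

text \<open>In the chart given by \<open>e\<close> the subspace with coordinates \<open>X\<close> is spanned by the vectors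
  \<open>graph_vector X i\<close>. Those for \<open>X0\<close> form a basis of \<open>\<A>\<close>, written \<open>a\<close>; together with the \<open>f j\<close>
  they form a basis of the whole space, with coordinate functionals \<open>\<alpha>\<close> and \<open>\<beta>\<close>. In this basis the
  coordinate matrix of a subspace becomes \<open>X - X0\<close>.\<close>

locale adapted_chart =
  fixes e :: "17 + 19 \<Rightarrow> complex^6^6" and X0 :: "complex^19^17"
  assumes basis: "is_basis e" and chart_X0: "gr_chart e X0 = \<A>"
begin

definition graph_vector :: "complex^19^17 \<Rightarrow> 17 \<Rightarrow> complex^6^6" where
  "graph_vector X i = e (Inl i) + (\<Sum>j\<in>UNIV. cscale (X $ i $ j) (e (Inr j)))"

abbreviation a :: "17 \<Rightarrow> complex^6^6" where "a \<equiv> graph_vector X0"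
abbreviation f :: "19 \<Rightarrow> complex^6^6" where "f j \<equiv> e (Inr j)"

definition e_coord :: "17 + 19 \<Rightarrow> complex^6^6 \<Rightarrow> complex" where
  "e_coord k M = cmat.representation (range e) M (e k)"

definition \<alpha> :: "17 \<Rightarrow> complex^6^6 \<Rightarrow> complex" where
  "\<alpha> i M = e_coord (Inl i) M"

definition \<beta> :: "19 \<Rightarrow> complex^6^6 \<Rightarrow> complex" where
  "\<beta> j M = e_coord (Inr j) M - (\<Sum>i\<in>UNIV. e_coord (Inl i) M * X0 $ i $ j)"

lemma gr_chart_eq: "gr_chart e X = cmat.span (range (graph_vector X))"
  by (simp add: gr_chart_def graph_vector_def)

lemma inj_e: "inj e" and independent_e: "cmat.independent (range e)"
  and in_span_e [simp]: "M \<in> cmat.span (range e)"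
  using basis by (simp_all add: is_basis_def)

lemma e_coord_linear [simp]:
  "e_coord k (M + N) = e_coord k M + e_coord k N" "e_coord k (cscale c M) = c * e_coord k M"
  by (simp_all add: e_coord_def cmat.representation_add cmat.representation_scale independent_e)

lemma e_coord_e [simp]: "e_coord k (e l) = (if k = l then 1 else 0)"
  using inj_e by (auto simp: e_coord_def cmat.representation_basis independent_e inj_eq)

lemma e_expansion: "M = (\<Sum>k\<in>UNIV. cscale (e_coord k M) (e k))"
proof -
  have "(\<Sum>b\<in>range e. cscale (cmat.representation (range e) M b) b) = M"
    by (rule cmat.sum_representation_eq) (simp_all add: independent_e)
  then show ?thesis by (simp add: sum.reindex[OF inj_e] e_coord_def)
qed

lemma sum_17_19: "(\<Sum>k\<in>UNIV. F k) = (\<Sum>i\<in>UNIV. F (Inl i)) + (\<Sum>j\<in>UNIV. F (Inr j))"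
  for F :: "17 + 19 \<Rightarrow> 'b::comm_monoid_add"
  unfolding UNIV_Plus_UNIV[symmetric] by (subst sum.Plus) simp_all

lemma \<alpha>_linear [simp]: "\<alpha> i (M + N) = \<alpha> i M + \<alpha> i N" "\<alpha> i (cscale c M) = c * \<alpha> i M"
  by (simp_all add: \<alpha>_def)

lemma \<beta>_linear [simp]: "\<beta> j (M + N) = \<beta> j M + \<beta> j N" "\<beta> j (cscale c M) = c * \<beta> j M"
  by (simp_all add: \<beta>_def sum.distrib sum_distrib_left algebra_simps)

lemma functional_zero [simp]: "\<alpha> i 0 = 0" "\<beta> j 0 = 0"
  using \<alpha>_linear(2)[of i 0 0] \<beta>_linear(2)[of j 0 0] by simp_all

lemma functional_sum [simp]:
  "\<alpha> i (\<Sum>k\<in>K. M k) = (\<Sum>k\<in>K. \<alpha> i (M k))" "\<beta> j (\<Sum>k\<in>K. M k) = (\<Sum>k\<in>K. \<beta> j (M k))"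
  by (induction K rule: infinite_finite_induct) simp_all

lemma functional_diff [simp]: "\<alpha> i (M - N) = \<alpha> i M - \<alpha> i N" "\<beta> j (M - N) = \<beta> j M - \<beta> j N"
  using \<alpha>_linear(1)[of i "M - N" N] \<beta>_linear(1)[of j "M - N" N] by simp_all

lemma functionals_f [simp]: "\<alpha> i (f j) = 0" "\<beta> l (f j) = (if l = j then 1 else 0)"
  by (simp_all add: \<alpha>_def \<beta>_def)

lemma \<alpha>_graph_vector [simp]: "\<alpha> i (graph_vector X k) = (if i = k then 1 else 0)"
proof -
  have "\<alpha> i (e (Inl k)) = (if i = k then 1 else 0)" by (simp add: \<alpha>_def)
  then show ?thesis by (simp add: graph_vector_def)
qed

lemma \<beta>_graph_vector [simp]: "\<beta> j (graph_vector X k) = X $ k $ j - X0 $ k $ j"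
proof -
  have "\<beta> j (e (Inl k)) = - X0 $ k $ j" by (simp add: \<beta>_def if_distrib if_distribR cong: if_cong)
  then show ?thesis by (simp add: graph_vector_def if_distrib if_distribR cong: if_cong)
qed

lemma graph_vector_eq: "graph_vector X i = a i + (\<Sum>j\<in>UNIV. cscale (X $ i $ j - X0 $ i $ j) (f j))"
  by (simp add: graph_vector_def cmat.scale_left_diff_distrib sum_subtractf)

lemma expansion: "M = (\<Sum>i\<in>UNIV. cscale (\<alpha> i M) (a i)) + (\<Sum>j\<in>UNIV. cscale (\<beta> j M) (f j))"
proof -
  have "(\<Sum>i\<in>UNIV. cscale (\<alpha> i M) (a i)) = (\<Sum>i\<in>UNIV. cscale (\<alpha> i M) (e (Inl i))) +
      (\<Sum>i\<in>UNIV. \<Sum>j\<in>UNIV. cscale (\<alpha> i M * X0 $ i $ j) (f j))"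
    by (simp add: graph_vector_def cmat.scale_right_distrib cmat.scale_sum_right sum.distrib)
  also have "(\<Sum>i\<in>UNIV. \<Sum>j\<in>UNIV. cscale (\<alpha> i M * X0 $ i $ j) (f j))
      = (\<Sum>j\<in>UNIV. cscale (\<Sum>i\<in>UNIV. \<alpha> i M * X0 $ i $ j) (f j))"
    by (subst sum.swap) (simp add: cmat.scale_sum_left)
  finally show ?thesis
    by (subst (1) e_expansion) (simp add: sum_17_19 \<alpha>_def \<beta>_def cmat.scale_left_diff_distrib
        sum_subtractf)
qed

lemma in_\<A>_iff_\<beta>: "M \<in> \<A> \<longleftrightarrow> (\<forall>j. \<beta> j M = 0)"
proof
  assume "M \<in> \<A>"
  then have "M \<in> cmat.span (range a)" by (simp add: gr_chart_eq flip: chart_X0)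
  then show "\<forall>j. \<beta> j M = 0"
    by (induction rule: cmat.span_induct_alt) auto
next
  assume "\<forall>j. \<beta> j M = 0"
  with expansion[of M] have "M = (\<Sum>i\<in>UNIV. cscale (\<alpha> i M) (a i))" by simp
  also have "\<dots> \<in> cmat.span (range a)"
    by (intro cmat.span_sum cmat.span_scale cmat.span_base) simp
  finally show "M \<in> \<A>" by (simp add: gr_chart_eq flip: chart_X0)
qed

lemma a_in_\<A> [simp]: "a i \<in> \<A>" by (simp add: in_\<A>_iff_\<beta>)

lemma \<A>_expansion: "M \<in> \<A> \<Longrightarrow> M = (\<Sum>i\<in>UNIV. cscale (\<alpha> i M) (a i))"
  by (rule trans[OF expansion]) (simp add: in_\<A>_iff_\<beta>)

section \<open>The orbit satisfies the rank condition\<close>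

lemma \<O>_subset_\<XX>: "\<O> \<subseteq> \<XX>"
proof
  fix V assume "V \<in> \<O>"
  then obtain g where g: "invertible g" and V: "V = conj_act g \<A>" by (auto simp: \<O>_def)
  define h where "h = matrix_inv g"
  have hg: "h ** g = mat 1" "g ** h = mat 1"
    using g unfolding h_def matrix_inv_def invertible_def by (metis (mono_tags, lifting) someI_ex)+
  let ?c = "\<lambda>i. g ** a i ** h"
  have V_span: "V = cmat.span (range ?c)"
    unfolding V conj_act_def chart_X0[symmetric] gr_chart_eq h_def[symmetric]
      clinear_span_image[OF clinear_conj] by (simp add: image_image)
  have ind: "\<forall>i\<in>UNIV. c i = 0" if 0: "(\<Sum>i\<in>UNIV. cscale (c i) (?c i)) = 0" for c
  proof
    fix k
    have "h ** (\<Sum>i\<in>UNIV. cscale (c i) (?c i)) ** g = (\<Sum>i\<in>UNIV. h ** cscale (c i) (?c i) ** g)"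
      by (rule clinear_sum[OF clinear_conj])
    also have "\<dots> = (\<Sum>i\<in>UNIV. cscale (c i) (a i))"
      by (simp add: cscale_mult_left cscale_mult_right hg flip: matrix_mul_assoc)
        (simp add: matrix_mul_assoc hg)
    finally have "\<alpha> k (\<Sum>i\<in>UNIV. cscale (c i) (a i)) = 0" using 0 by simp
    then show "c k = 0" by (simp add: if_distrib if_distribR cong: if_cong)
  qed
  have "cmat.dim V = card (range ?c)"
    unfolding V_span by (intro cmat.dim_span_eq_card_independent independent_familyI(2)[OF
        finite_class.finite_UNIV] ind)
  also have "\<dots> = 17"
    using card_image[OF independent_familyI(1)[OF finite_class.finite_UNIV ind]] by simp
  finally have "V \<in> grassmannian 17" by (simp add: grassmannian_def V_span)
  moreover have "rank (commutator S T) \<le> 2" if ST: "S \<in> V" "T \<in> V" for S T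
  proof -
    obtain S' T' where S': "S' \<in> \<A>" "S = g ** S' ** h" and T': "T' \<in> \<A>" "T = g ** T' ** h"
      using ST unfolding V conj_act_def h_def by blast
    have "rank (commutator S T) \<le> rank (commutator S' T')"
      unfolding S' T' conj_commutator[OF hg(1)]
      by (meson rank_mult_le_left rank_mult_le_right order_trans)
    then show ?thesis using rank_commutator_\<A>[OF S'(1) T'(1)] by linarith
  qed
  ultimately show "V \<in> \<XX>" by (simp add: \<XX>_def)
qed

section \<open>Tangent vectors to the rank locus\<close>

text \<open>Over the whole chart, \<open>lift\<close> is an algebraic family of elements of the subspaces, extending
  a given element of \<open>\<A>\<close>; \<open>first_order_lift Y\<close> is its derivative in direction \<open>Y\<close>, the linear map
  that represents the tangent vector \<open>Y\<close>.\<close>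

definition lift :: "complex^19^17 \<Rightarrow> complex^6^6 \<Rightarrow> complex^6^6" where
  "lift X S = (\<Sum>i\<in>UNIV. cscale (\<alpha> i S) (graph_vector X i))"

definition first_order_lift :: "complex^19^17 \<Rightarrow> complex^6^6 \<Rightarrow> complex^6^6" where
  "first_order_lift Y S = (\<Sum>i\<in>UNIV. cscale (\<alpha> i S) (\<Sum>j\<in>UNIV. cscale (Y $ i $ j) (f j)))"

lemma lift_in_chart: "lift X S \<in> gr_chart e X"
  unfolding lift_def gr_chart_eq by (intro cmat.span_sum cmat.span_scale cmat.span_base) simp

lemma lift_X0: "S \<in> \<A> \<Longrightarrow> lift X0 S = S"
  unfolding lift_def by (rule \<A>_expansion[symmetric])

lemma lift_add: "lift (X0 + cscale t Y) S = lift X0 S + cscale t (first_order_lift Y S)"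
proof -
  have "graph_vector (X0 + cscale t Y) i = a i + cscale t (\<Sum>j\<in>UNIV. cscale (Y $ i $ j) (f j))" for i
    by (subst graph_vector_eq) (simp add: cmat.scale_sum_right)
  then show ?thesis
    by (simp add: lift_def first_order_lift_def cmat.scale_right_distrib sum.distrib
        cmat.scale_sum_right mult.left_commute)
qed

lemma mat_polynomial_lift: "mat_polynomial (\<lambda>X. lift X S)"
  unfolding mat_polynomial_def lift_def graph_vector_def
  by (auto intro!: cpolynomial_sum cpolynomial.intros)

lemma clinear_first_order_lift: "clinear (first_order_lift Y)"
  by (rule clinearI)
    (simp_all add: first_order_lift_def cmat.scale_left_distrib sum.distrib cmat.scale_sum_right
      distrib_right mult.assoc)

lemma \<beta>_first_order_lift [simp]: "\<beta> j (first_order_lift Y (a i)) = Y $ i $ j"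
  by (simp add: first_order_lift_def if_distrib if_distribR cong: if_cong)

text \<open>The minor of the commutator of the two lifts is a polynomial in the chart that vanishes on
  \<open>\<XX>\<close>; it is restricted to the line through \<open>X0\<close> in direction \<open>Y\<close>.\<close>

lemma minor_derivative:
  fixes U :: "complex^6^3" and W :: "complex^3^6"
  assumes Y: "Y \<in> gr_tangent e \<XX> X0" and S: "S \<in> \<A>" and T: "T \<in> \<A>"
  defines "\<phi> \<equiv> first_order_lift Y"
  shows "((\<lambda>t. det (U ** commutator S T ** W
       + cscale t (U ** (commutator (\<phi> S) T + commutator S (\<phi> T)) ** W)
       + cscale (t * t) (U ** commutator (\<phi> S) (\<phi> T) ** W))) has_field_derivative 0) (at 0)"
proof -
  define p where "p X = det (U ** commutator (lift X S) (lift X T) ** W)" for X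
  have "cpolynomial p" unfolding p_def
    by (intro cpolynomial_det_3 mat_polynomial_mult mat_polynomial_const mat_polynomial_commutator
        mat_polynomial_lift)
  moreover have "p X = 0" if "gr_chart e X \<in> \<XX>" for X
    unfolding p_def by (rule minor_eq_0_if_rank_le_2) (use that lift_in_chart in \<open>simp add: \<XX>_def\<close>)
  ultimately have p: "cpolynomial p" "p \<in> vanishing_ideal (gr_chart e -` \<XX>)"
    by (auto simp: vanishing_ideal_def)
  have "((\<lambda>t. p (X0 + cscale t Y)) has_field_derivative frechet_derivative p (at (X0
      + cscale 0 Y)) Y) (at 0)"
    by (rule cpolynomial_chain[OF p(1)]) (auto intro!: derivative_eq_intros)
  moreover have "frechet_derivative p (at X0) Y = 0"
    using Y p(2) by (simp add: gr_tangent_def zariski_tangent_def)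
  ultimately have 0: "((\<lambda>t. p (X0 + cscale t Y)) has_field_derivative 0) (at 0)" by simp
  have "p (X0 + cscale t Y) = det (U ** commutator S T ** W
       + cscale t (U ** (commutator (\<phi> S) T + commutator S (\<phi> T)) ** W)
       + cscale (t * t) (U ** commutator (\<phi> S) (\<phi> T) ** W))" for t
  proof -
    have "commutator (lift (X0 + cscale t Y) S) (lift (X0 + cscale t Y) T) = commutator S T
       + cscale t (commutator (\<phi> S) T + commutator S (\<phi> T)) + cscale (t * t) (commutator (\<phi> S) (\<phi> T))"
      unfolding lift_add lift_X0[OF S] lift_X0[OF T] \<phi>_def[symmetric]
      by (simp add: commutator_def matrix_distribs cscale_mult_left cscale_mult_right
        cmat.scale_right_distrib cmat.scale_right_diff_distrib)
    then show ?thesis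
      by (simp add: p_def matrix_distribs cscale_mult_left cscale_mult_right)
  qed
  with 0 show ?thesis by simp
qed

text \<open>The minor is chosen so that at \<open>t = 0\<close> it is the diagonal matrix with entries \<open>1, 1, 0\<close>: two
  columns of \<open>W\<close> are preimages under \<open>[S, T]\<close> of the first two basis vectors, which exist as the
  upper left block is invertible, and the third column is a column of \<open>V\<close>. The rows select the
  first two coordinates and one coordinate below them. The derivative of the minor is then the
  entry of \<open>([\<phi> S, T] + [S, \<phi> T]) V\<close> in question.\<close>

lemma tangent_first_order_solution:
  assumes Y: "Y \<in> gr_tangent e \<XX> X0"
  shows "first_order_solution (first_order_lift Y)"
proof (rule first_order_solution.intro)
  let ?\<phi> = "first_order_lift Y"
  show "clinear ?\<phi>" by (rule clinear_first_order_lift)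
  fix S T :: "complex^6^6" and V :: "complex^2^6" and k :: 3
  assume S: "S \<in> \<A>" and T: "T \<in> \<A>" and inv: "invertible (block 1 1 (commutator S T))"
    and V: "commutator S T ** V = 0" and k: "k \<noteq> 1"
  let ?M = "commutator S T" and ?N = "commutator (?\<phi> S) T + commutator S (?\<phi> T)"
  obtain L where L: "block 1 1 ?M ** L = mat 1"
    using inv by (auto simp: invertible_def)
  have lower: "block l m ?M = 0" if "l \<noteq> 1" for l m :: 3
    by (rule lower_blocks_commutator_\<A>[OF S T that])
  have ML0: "?M ** stack L 0 0 = stack (mat 1) 0 0"
  proof (rule row_block_eqI)
    fix l show "row_block l (?M ** stack L 0 0) = row_block l (stack (mat 1) 0 0)"
      using exhaust_3[of l] by (auto simp: row_block_mult L lower)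
  qed
  have "(?N ** V) $ block_index k p $ q = 0" for p q
  proof -
    let ?i = "block_index k p"
    define \<rho> :: "3 \<Rightarrow> 6" where "\<rho> r = (if r = 1 then 1 else if r = 2 then 2 else ?i)" for r
    define U :: "complex^6^3" where "U = (\<chi> r j. if j = \<rho> r then 1 else 0)"
    define W :: "complex^3^6" where
      "W = (\<chi> j r. if r = 1 then stack L 0 0 $ j $ 1 else if r
          = 2 then stack L 0 0 $ j $ 2 else V $ j $ q)"
    have UMW: "(U ** M ** W) $ r $ s = (if s = 1 then (M ** stack L 0 0) $ \<rho> r $ 1
       else if s = 2 then (M ** stack L 0 0) $ \<rho> r $ 2 else (M ** V) $ \<rho> r $ q)" for M r s
    proof -
      have "(U ** M ** W) $ r $ s = (U ** (M ** W)) $ r $ s" by (simp add: matrix_mul_assoc)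
      also have "\<dots> = (M ** W) $ \<rho> r $ s"
        by (subst matrix_matrix_mult_def[of U]) (simp add: U_def if_distrib if_distribR cong: if_cong)
      finally show ?thesis by (simp add: matrix_matrix_mult_def W_def)
    qed
    have E: "stack (mat 1) 0 0 $ 1 $ 1 = 1" "stack (mat 1) 0 0 $ 1 $ 2 = 0"
      "stack (mat 1) 0 0 $ 2 $ 1 = 0" "stack (mat 1) 0 0 $ 2 $ 2 = 1"
      "stack (mat 1) 0 0 $ ?i $ c = 0" for c
      using k exhaust_3[of k]
      by (auto simp: stack_def block_of_def[of 1] block_of_def[of 2] pos_in_block_def[of 1]
          pos_in_block_def[of 2])
    have "(U ** ?N ** W) $ 3 $ 3 = 0"
    proof (rule det_expansion_first_order[OF _ _ _ _ _ _ _ _ _ minor_derivative[OF Y S T]])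
    qed (simp_all add: UMW ML0 V \<rho>_def E)
    then show ?thesis by (simp add: UMW \<rho>_def)
  qed
  then show "row_block k (?N ** V) = 0" by (simp add: row_block_def vec_eq_iff)
qed

text \<open>The tangent vector at \<open>\<A>\<close> to the orbit in the direction of the Lie algebra element \<open>x\<close>.\<close>

definition inner_tangent :: "complex^6^6 \<Rightarrow> complex^19^17" where
  "inner_tangent x = (\<chi> i j. \<beta> j (commutator x (a i)))"

lemma tangent_\<XX>_inner:
  assumes "Y \<in> gr_tangent e \<XX> X0"
  shows "\<exists>y21 y31 y32. Y = inner_tangent (lower_block_matrix y21 y31 y32)"
proof -
  obtain y21 y31 y32 where y: "\<And>S. S \<in> \<A> \<Longrightarrow> first_order_lift Y S - commutator (lower_block_matrix y21
      y31 y32) S \<in> \<A>"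
    using first_order_solution.\<phi>_is_inner[OF tangent_first_order_solution[OF assms]]
    unfolding lower_block_matrix_def by blast
  have "Y $ i $ j = \<beta> j (commutator (lower_block_matrix y21 y31 y32) (a i))" for i j
    using y[OF a_in_\<A>[of i]] by (simp add: in_\<A>_iff_\<beta>)
  then have "Y = inner_tangent (lower_block_matrix y21 y31 y32)"
    by (simp add: inner_tangent_def vec_eq_iff)
  then show ?thesis by blast
qed

section \<open>Tangent vectors to the orbit\<close>

text \<open>The curve \<open>t \<mapsto> (1 + t x) \<A> (1 - t x)\<close> in the orbit is spanned by the vectors \<open>m t i\<close>, whose
  coefficients \<open>P t\<close>, \<open>Q t\<close> in the adapted basis are polynomials in \<open>t\<close>. Its coordinates in the
  chart are \<open>X0 + Z t\<close> with \<open>P t Z t = Q t\<close>. At \<open>t = 0\<close> one has \<open>P = 1\<close> and \<open>Z = Q = 0\<close>, so \<open>Z\<close>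
  and \<open>Q\<close> have the same derivative, which is \<open>inner_tangent x\<close>.\<close>

lemma inner_tangent_in_tangent_\<O>:
  assumes sq: "x ** x = 0"
  shows "inner_tangent x \<in> gr_tangent e \<O> X0"
proof -
  define g where "g t = mat 1 + cscale t x" for t
  define h where "h t = mat 1 - cscale t x" for t
  have gh: "g t ** h t = mat 1" "h t ** g t = mat 1" for t
    by (simp_all add: g_def h_def matrix_distribs cscale_mult_left cscale_mult_right sq)
  define m where "m t i = g t ** a i ** h t" for t i
  have m: "m t i = a i + cscale t (commutator x (a i)) - cscale (t * t) (x ** a i ** x)" for t i
    by (simp add: m_def g_def h_def commutator_def matrix_distribs cscale_mult_left cscale_mult_right
      cmat.scale_right_diff_distrib cmat.scale_right_distrib)
  define P :: "complex \<Rightarrow> complex^17^17" where "P t = (\<chi> i k. \<alpha> k (m t i))" for t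
  define Q :: "complex \<Rightarrow> complex^19^17" where "Q t = (\<chi> i j. \<beta> j (m t i))" for t
  \<comment> \<open>Cramer's rule, column by column, for \<open>P t ** Z t = Q t\<close>.\<close>
  define Z :: "complex \<Rightarrow> complex^19^17" where
    "Z t = (\<chi> k j. det (\<chi> i l. if l = k then Q t $ i $ j else P t $ i $ l) / det (P t))" for t
  have P_deriv: "((\<lambda>t. P t $ i $ k) has_field_derivative \<alpha> k (commutator x (a i))) (at 0)" for i k
    unfolding P_def m by (auto intro!: derivative_eq_intros)
  then have P_diff: "(\<lambda>t. P t $ i $ k) field_differentiable (at 0)" for i k
    using field_differentiable_def by blast
  have Q_deriv: "((\<lambda>t. Q t $ i $ j) has_field_derivative \<beta> j (commutator x (a i))) (at 0)" for i j
    unfolding Q_def m by (auto intro!: derivative_eq_intros)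
  then have Q_diff: "(\<lambda>t. Q t $ i $ j) field_differentiable (at 0)" for i j
    using field_differentiable_def by blast
  have P0: "P 0 = mat 1" by (simp add: P_def m mat_def vec_eq_iff)
  have Q0: "Q 0 = 0" by (simp add: Q_def m vec_eq_iff)
  have det_diff: "(\<lambda>t. det (P t)) field_differentiable (at 0)"
    by (intro det_field_differentiable P_diff)
  have "(\<lambda>t. Z t $ k $ j) field_differentiable (at 0)" for k j
  proof -
    have "(\<lambda>t. if l = k then Q t $ i $ j else P t $ i $ l) field_differentiable (at 0)" for i l
      by (cases "l = k") (simp_all add: P_diff Q_diff)
    then have "(\<lambda>t. det (\<chi> i l. if l = k then Q t $ i $ j else P t $ i $ l) / det (P t))
        field_differentiable (at 0)"
      by (intro field_differentiable_divide det_diff det_field_differentiable)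
        (simp_all add: P0)
    then show ?thesis by (simp add: Z_def)
  qed
  then obtain Z' where Z': "((\<lambda>t. Z t $ k $ j) has_field_derivative Z' k j) (at 0)" for k j
    unfolding field_differentiable_def by metis
  have PZ: "P t ** Z t = Q t" if "det (P t) \<noteq> 0" for t
  proof -
    have "(P t ** Z t) $ i $ j = Q t $ i $ j" for i j
    proof -
      have "P t *v (\<chi> k. Z t $ k $ j) = (\<chi> i. Q t $ i $ j)"
        by (subst cramer[OF that]) (simp add: Z_def cong: if_cong)
      from arg_cong[OF this, of "\<lambda>v. v $ i"] show ?thesis
        by (simp add: matrix_vector_mult_def matrix_matrix_mult_def)
    qed
    then show ?thesis by (simp add: vec_eq_iff)
  qed
  have Z0: "Z 0 = 0" using PZ[of 0] by (simp add: P0 Q0)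
  have "continuous (at 0) (\<lambda>t. det (P t))"
    using det_diff by (rule field_differentiable_imp_continuous_at)
  then have ev: "\<forall>\<^sub>F t in nhds 0. det (P t) \<noteq> 0"
    unfolding eventually_nhds_conv_at continuous_at
    by (auto simp: P0 intro: tendsto_imp_eventually_ne)
  have Z'_eq: "Z' i j = \<beta> j (commutator x (a i))" for i j
  proof -
    have "((\<lambda>t. (P t ** Z t) $ i $ j) has_field_derivative
        (\<Sum>k\<in>UNIV. \<alpha> k (commutator x (a i)) * Z 0 $ k $ j + Z' k j * P 0 $ i $ k)) (at 0)"
      unfolding matrix_matrix_mult_def by (auto intro!: DERIV_sum DERIV_mult P_deriv Z')
    also have "(\<Sum>k\<in>UNIV. \<alpha> k (commutator x (a i)) * Z 0 $ k $ j + Z' k j * P 0 $ i $ k) = Z' i j"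
      by (simp add: Z0 P0 mat_def if_distrib if_distribR cong: if_cong)
    finally have 1: "((\<lambda>t. (P t ** Z t) $ i $ j) has_field_derivative Z' i j) (at 0)" .
    have "\<forall>\<^sub>F t in nhds 0. (P t ** Z t) $ i $ j = Q t $ i $ j"
      using ev by eventually_elim (simp add: PZ)
    then have "((\<lambda>t. Q t $ i $ j) has_field_derivative Z' i j) (at 0)"
      using 1 by (subst (asm) DERIV_cong_ev[OF refl _ refl]) auto
    then show ?thesis using Q_deriv[of i j] DERIV_unique by blast
  qed
  have in_orbit: "gr_chart e (X0 + Z t) \<in> \<O>" if t: "det (P t) \<noteq> 0" for t
  proof -
    let ?v = "graph_vector (X0 + Z t)"
    have m_eq: "m t i = (\<Sum>k\<in>UNIV. cscale (P t $ i $ k) (?v k))" for i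
    proof -
      have "m t i = (\<Sum>k\<in>UNIV. cscale (P t $ i $ k) (a k)) + (\<Sum>j\<in>UNIV. cscale (Q t $ i $ j) (f j))"
        using expansion[of "m t i"] by (simp add: P_def Q_def)
      also have "(\<Sum>j\<in>UNIV. cscale (Q t $ i $ j) (f j)) =
          (\<Sum>j\<in>UNIV. \<Sum>k\<in>UNIV. cscale (P t $ i $ k * Z t $ k $ j) (f j))"
        by (simp add: matrix_matrix_mult_def cmat.scale_sum_left flip: PZ[OF t])
      also have "\<dots> = (\<Sum>k\<in>UNIV. cscale (P t $ i $ k) (\<Sum>j\<in>UNIV. cscale (Z t $ k $ j) (f j)))"
        by (subst sum.swap) (simp add: cmat.scale_sum_right)
      finally show ?thesis
        by (subst graph_vector_eq) (simp add: cmat.scale_right_distrib sum.distrib)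
    qed
    obtain R where R: "R ** P t = mat 1"
      using t by (meson invertible_det_nz invertible_left_inverse)
    have v_eq: "?v k = (\<Sum>i\<in>UNIV. cscale (R $ k $ i) (m t i))" for k
    proof -
      have "(\<Sum>i\<in>UNIV. cscale (R $ k $ i) (m t i)) = (\<Sum>l\<in>UNIV. cscale ((R ** P t) $ k $ l) (?v l))"
        unfolding m_eq cmat.scale_sum_right
        by (subst sum.swap) (simp add: matrix_matrix_mult_def cmat.scale_sum_left)
      also have "\<dots> = (\<Sum>l\<in>UNIV. if k = l then ?v l else 0)"
        unfolding R by (intro sum.cong refl) (simp add: mat_def)
      finally show ?thesis by simp
    qed
    have "cmat.span (range ?v) = cmat.span (range (m t))"
    proof (rule cmat.span_eq[THEN iffD2], intro conjI subsetI)
      fix y assume "y \<in> range ?v"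
      then show "y \<in> cmat.span (range (m t))"
        using v_eq by (auto intro!: cmat.span_sum cmat.span_scale intro: cmat.span_base)
    next
      fix y assume "y \<in> range (m t)"
      then show "y \<in> cmat.span (range ?v)"
        using m_eq by (auto intro!: cmat.span_sum cmat.span_scale intro: cmat.span_base)
    qed
    moreover have "conj_act (g t) \<A> = cmat.span (range (m t))"
      unfolding conj_act_def conj_inverse(2)[OF gh] chart_X0[symmetric] gr_chart_eq
        clinear_span_image[OF clinear_conj] by (simp add: image_image m_def)
    ultimately show ?thesis
      using conj_inverse(1)[OF gh] by (auto simp: \<O>_def gr_chart_eq)
  qed
  have "frechet_derivative p (at X0) (inner_tangent x) = 0" if p: "p \<in> vanishing_ideal (gr_chart e
      -` \<O>)" for p
  proof -
    have "((\<lambda>t. p (X0 + Z t)) has_field_derivative frechet_derivative p (at (X0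
        + Z 0)) (inner_tangent x)) (at 0)"
      using p Z' by (intro cpolynomial_chain)
        (auto simp: vanishing_ideal_def inner_tangent_def Z'_eq intro!: derivative_eq_intros)
    then have 1: "((\<lambda>t. p (X0 + Z t)) has_field_derivative frechet_derivative p (at X0)
        (inner_tangent x)) (at 0)"
      by (simp add: Z0)
    have "\<forall>\<^sub>F t in nhds 0. p (X0 + Z t) = 0"
      using ev by eventually_elim (use p in_orbit in \<open>auto simp: vanishing_ideal_def\<close>)
    then have "((\<lambda>t. 0) has_field_derivative frechet_derivative p (at X0) (inner_tangent x)) (at 0)"
      using 1 by (subst (asm) DERIV_cong_ev[OF refl _ refl]) auto
    then show ?thesis using DERIV_unique DERIV_const by blast
  qed
  then show ?thesis by (simp add: gr_tangent_def zariski_tangent_def)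
qed

end

section \<open>The tangent space and its dimension\<close>

text \<open>The positions strictly below the diagonal blocks.\<close>

definition lower_positions :: "(6 \<times> 6) set" where
  "lower_positions = {3, 4} \<times> {1, 2} \<union> {5, 6} \<times> {1, 2, 3, 4}"

lemma card_lower_positions: "card lower_positions = 12"
  unfolding lower_positions_def by (subst card_Un_disjoint) (auto simp: card_cartesian_product)

lemma lower_positions_off_diagonal: "p \<in> lower_positions \<Longrightarrow> fst p \<noteq> snd p"
  by (auto simp: lower_positions_def)

lemma lower_block_matrix_entry:
  "(i, j) \<notin> lower_positions \<Longrightarrow> lower_block_matrix y21 y31 y32 $ i $ j = 0"
proof -
  have "\<forall>i j. (i, j) \<notin> lower_positions \<longrightarrow> lower_block_matrix y21 y31 y32 $ i $ j = 0"
    unfolding forall_6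
    by (simp add: lower_positions_def lower_block_matrix_def block_matrix_def block_of_def
        pos_in_block_def)
  then show "(i, j) \<notin> lower_positions \<Longrightarrow> ?thesis" by blast
qed

lemma upper_blocks_eq_0:
  assumes "\<And>i j. (i, j) \<notin> lower_positions \<Longrightarrow> x $ i $ j = 0"
  shows "block 1 l x = 0" "block 2 2 x = 0" "block 2 3 x = 0" "block 3 3 x = 0"
  by (simp_all add: vec_eq_iff block_def)
    (auto intro!: assms simp: lower_positions_def block_index_def)

definition unit_at :: "6 \<times> 6 \<Rightarrow> complex^6^6" where "unit_at p = mat_unit (fst p) (snd p)"

lemma unit_sum_entry:
  "(\<Sum>p\<in>lower_positions. cscale (c p) (unit_at p)) $ i $ j
      = (if (i, j) \<in> lower_positions then c (i, j) else 0)"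
proof -
  have "finite lower_positions" by (simp add: lower_positions_def)
  have "(\<Sum>p\<in>lower_positions. cscale (c p) (unit_at p)) $ i $ j =
      (\<Sum>p\<in>lower_positions. cscale (c p) (unit_at p) $ i $ j)"
    by simp
  also have "\<dots> = (\<Sum>p\<in>lower_positions. if (i, j) = p then c p else 0)"
    by (intro sum.cong refl) (auto simp: unit_at_def)
  finally show ?thesis using \<open>finite lower_positions\<close> by simp
qed

lemma unit_at_square: "p \<in> lower_positions \<Longrightarrow> cscale c (unit_at p) ** cscale c (unit_at p) = 0"
  using lower_positions_off_diagonal[of p]
  by (auto simp: unit_at_def vec_eq_iff matrix_matrix_mult_def intro!: sum.neutral)

context adapted_chart begin

lemma clinear_inner_tangent: "clinear inner_tangent"
proof -
  have *: "commutator (x + y) M = commutator x M + commutator y M"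
    "commutator (cscale c x) M = cscale c (commutator x M)" for x y c and M :: "complex^6^6"
    by (simp_all add: commutator_def matrix_distribs cscale_mult_left cscale_mult_right
        cmat.scale_right_diff_distrib)
  show ?thesis
    by (intro clinearI) (simp_all add: inner_tangent_def vec_eq_iff[where 'b=17] vec_eq_iff[where
        'b=19] *)
qed

lemma inner_tangent_lower_sum:
  "inner_tangent (\<Sum>p\<in>lower_positions. cscale (c p) (unit_at p)) =
     (\<Sum>p\<in>lower_positions. cscale (c p) (inner_tangent (unit_at p)))"
  by (simp add: clinear_sum[OF clinear_inner_tangent] clinear_cscale[OF clinear_inner_tangent])

lemma inner_tangent_unit: "p \<in> lower_positions \<Longrightarrow> cscale c (inner_tangent (unit_at p)) \<in> gr_tangent e
    \<O> X0"
  using inner_tangent_in_tangent_\<O>[OF unit_at_square[of p c]]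
      by (simp add: clinear_cscale[OF clinear_inner_tangent])

text \<open>The hypothesis means that \<open>x\<close> normalizes \<open>\<A>\<close>. The idempotent onto the first block shows that
  the first block column of \<open>x\<close> vanishes, which leaves a single block \<open>x32\<close>. For the element with
  \<open>D = 1\<close> as its only block, the second and third diagonal blocks of the commutator are \<open>-x32\<close> and
  \<open>x32\<close>; they must be equal, so \<open>x32 = 0\<close>.\<close>

lemma inner_tangent_eq_0:
  assumes x: "\<And>i j. (i, j) \<notin> lower_positions \<Longrightarrow> x $ i $ j = 0" and 0: "inner_tangent x = 0"
  shows "x = 0"
proof -
  have base: "commutator x (a i) \<in> \<A>" for i
    using 0 by (simp add: inner_tangent_def vec_eq_iff in_\<A>_iff_\<beta>)
  have comm: "commutator x S \<in> \<A>" if "S \<in> \<A>" for S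
  proof -
    have "clinear (commutator x)"
      by (rule clinearI) (simp_all add: commutator_def matrix_distribs cscale_mult_left
          cscale_mult_right cmat.scale_right_diff_distrib)
    note lin = clinear_sum[OF this] clinear_cscale[OF this]
    have "commutator x S = (\<Sum>i\<in>UNIV. cscale (\<alpha> i S) (commutator x (a i)))"
      by (subst \<A>_expansion[OF that]) (simp add: lin)
    then show ?thesis using base by (simp add: in_\<A>_iff_\<beta>)
  qed
  note up = upper_blocks_eq_0[of x, OF x]
  note blocks = commutator_def block_diff block_mult up
  have 1: "block 2 1 x = 0" "block 3 1 x = 0"
    using comm[of "flag_matrix (mat 1) 0 0 0 0"] exI[of "\<lambda>c. mat c = (0 :: complex^2^2)" 0]
    by (simp_all add: in_\<A>_iff blocks)
  have 2: "block 3 2 x = 0"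
    using comm[of "flag_matrix 0 0 0 (mat 1) 0"] by (auto simp: in_\<A>_iff blocks 1 mat2_eq)
  show ?thesis
  proof (rule block_eqI)
    fix k l show "block k l x = block k l 0"
      using exhaust_3[of k] exhaust_3[of l] by (auto simp: up 1 2 block_zero)
  qed
qed

lemma tangent_\<XX>_span:
  assumes "Y \<in> gr_tangent e \<XX> X0"
  shows "\<exists>c. Y = (\<Sum>p\<in>lower_positions. cscale (c p) (inner_tangent (unit_at p)))"
proof -
  obtain y21 y31 y32 where Y: "Y = inner_tangent (lower_block_matrix y21 y31 y32)"
    using tangent_\<XX>_inner[OF assms] by blast
  have eq: "lower_block_matrix y21 y31 y32 =
      (\<Sum>p\<in>lower_positions. cscale (lower_block_matrix y21 y31 y32 $ fst p $ snd p) (unit_at p))"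
    unfolding vec_eq_iff unit_sum_entry using lower_block_matrix_entry by simp
  show ?thesis
    by (rule exI) (rule trans[OF Y trans[OF arg_cong[OF eq, of inner_tangent]
        inner_tangent_lower_sum]])
qed

lemma tangent_eq: "gr_tangent e \<XX> X0 = gr_tangent e \<O> X0"
proof
  show "gr_tangent e \<O> X0 \<subseteq> gr_tangent e \<XX> X0"
    unfolding gr_tangent_def by (intro zariski_tangent_mono vimage_mono \<O>_subset_\<XX>)
  show "gr_tangent e \<XX> X0 \<subseteq> gr_tangent e \<O> X0"
  proof
    fix Y assume "Y \<in> gr_tangent e \<XX> X0"
    then obtain c where "Y = (\<Sum>p\<in>lower_positions. cscale (c p) (inner_tangent (unit_at p)))"
      using tangent_\<XX>_span by blast
    then show "Y \<in> gr_tangent e \<O> X0"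
      using inner_tangent_unit unfolding gr_tangent_def by (auto intro: zariski_tangent_sum)
  qed
qed

lemma tangent_dim: "cmat.dim (gr_tangent e \<XX> X0) = 12"
proof -
  let ?w = "\<lambda>p. inner_tangent (unit_at p)"
  have fin: "finite lower_positions" by (simp add: lower_positions_def)
  have ind: "\<forall>p\<in>lower_positions. c p = 0" if "(\<Sum>p\<in>lower_positions. cscale (c p) (?w p)) = 0" for c
  proof -
    let ?x = "\<Sum>p\<in>lower_positions. cscale (c p) (unit_at p)"
    have "?x = 0"
      by (rule inner_tangent_eq_0) (simp_all only: unit_sum_entry if_False inner_tangent_lower_sum
          that)
    then have *: "?x $ i $ j = 0" for i j by simp
    have "c (i, j) = 0" if "(i, j) \<in> lower_positions" for i j
      using *[of i j] that unfolding unit_sum_entry by simp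
    then show ?thesis by auto
  qed
  show ?thesis
  proof (rule cmat.dim_unique)
    show "?w ` lower_positions \<subseteq> gr_tangent e \<XX> X0"
      unfolding tangent_eq using inner_tangent_unit[of _ 1] by auto
    show "gr_tangent e \<XX> X0 \<subseteq> cmat.span (?w ` lower_positions)"
    proof
      fix Y assume "Y \<in> gr_tangent e \<XX> X0"
      then obtain c where "Y = (\<Sum>p\<in>lower_positions. cscale (c p) (?w p))"
        using tangent_\<XX>_span by blast
      then show "Y \<in> cmat.span (?w ` lower_positions)"
        by (auto intro!: cmat.span_sum cmat.span_scale intro: cmat.span_base)
    qed
    show "cmat.independent (?w ` lower_positions)" by (rule independent_familyI(2)[OF fin ind])
    show "card (?w ` lower_positions) = 12"
      using card_image[OF independent_familyI(1)[OF fin ind]] card_lower_positions by simp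
  qed
qed

end

theorem theorem3p4:
  fixes e :: "17 + 19 \<Rightarrow> complex^6^6" and X0 :: "complex^19^17"
  assumes "is_basis e" and "gr_chart e X0 = \<A>"
  shows "gr_tangent e \<XX> X0 = gr_tangent e \<O> X0 \<and> cmat.dim (gr_tangent e \<XX> X0) = 12"
proof -
  interpret adapted_chart e X0 using assms by unfold_locales
  show ?thesis using tangent_eq tangent_dim by blast
qed

end
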